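(* Let $K$ be a subfield of $\overline{\mathbb{Q}}$, and let $\alpha \in \overline{\mathbb{Q}}^{\times}$. Then $$\tfrac12 W_K(\alpha) \le V_K(\alpha) \le W_K(\alpha).$$
   Context: $\overline{\mathbb{Q}}$ is a fixed algebraic closure of $\mathbb{Q}$ and $h : \overline{\mathbb{Q}}^{\times} \to [0,\infty)$ is the absolute logarithmic Weil height. For a subfield $K \subseteq \overline{\mathbb{Q}}$ let $K^{\mathrm{div}} = \{\gamma \in \overline{\mathbb{Q}}^{\times} : \gamma^m \in K^{\times} \text{ for some integer } m \neq 0\}$. Let $\mathrm{Aut}(\overline{\mathbb{Q}}/K)$ be the group of automorphisms of $\overline{\mathbb{Q}}$ fixing each element of $K$. For $\alpha \in \overline{\mathbb{Q}}^{\times}$ define $$V_K(\alpha) = \inf\{h(\alpha/\gamma) : \gamma \in K^{\mathrm{div}}\}, \qquad W_K(\alpha) = \sup\{h(\sigma\alpha/\alpha) : \sigma \in \mathrm{Aut}(\overline{\mathbb{Q}}/K)\}.$$ *)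

theory Defs
  imports
    "HOL-Algebra.Algebraic_Closure_Type"
    "HOL-Algebra.QuotRing"
    "HOL-Analysis.Infinite_Sum"
begin

type_synonym qbar = "rat alg_closure"

abbreviation Qbar_ring :: "qbar ring" where
  "Qbar_ring \<equiv> ring_of_type_algebra"

definition Aut_over :: "qbar set \<Rightarrow> (qbar \<Rightarrow> qbar) set" where
  "Aut_over K = {\<sigma> \<in> ring_iso Qbar_ring Qbar_ring. \<forall>x\<in>K. \<sigma> x = x}"


subsection \<open>The absolute logarithmic Weil height\<close>

definition is_absolute_value :: "('a::field \<Rightarrow> real) \<Rightarrow> bool" where
  "is_absolute_value v \<longleftrightarrow>
     (\<forall>x. 0 \<le> v x) \<and> (\<forall>x. v x = 0 \<longleftrightarrow> x = 0) \<and>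
     (\<forall>x y. v (x * y) = v x * v y) \<and> (\<forall>x y. v (x + y) \<le> v x + v y)"

definition padic_abs :: "nat \<Rightarrow> rat \<Rightarrow> real" where
  "padic_abs p q = (case quotient_of q of (a, b) \<Rightarrow>
     if q = 0 then 0
     else real p powi (int (multiplicity (int p) b) - int (multiplicity (int p) a)))"

text \<open>The places of the rationals, each represented by its normalised absolute value.\<close>

definition places_Q :: "(rat \<Rightarrow> real) set" where
  "places_Q = insert (\<lambda>q. \<bar>real_of_rat q\<bar>) {padic_abs p | p. prime p}"

text \<open>
  For every place \<open>v\<close> of the rationals we fix an absolute value on the algebraic closure that
  extends \<open>v\<close>. Such an extension always exists, and any two of them differ by an automorphism
  over the rationals, so the height below does not depend on the choice.
\<close>

definition place_ext :: "(rat \<Rightarrow> real) \<Rightarrow> qbar \<Rightarrow> real" where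
  "place_ext v = (SOME w. is_absolute_value w \<and> (\<forall>q. w (to_ac q) = v q))"

definition conjugates :: "qbar \<Rightarrow> qbar set" where
  "conjugates \<alpha> = (\<lambda>\<sigma>. \<sigma> \<alpha>) ` Aut_over (range to_ac)"

text \<open>
  The Weil height
  \<open>h(\<alpha>) = (1/[F : Q]) \<Sum>\<^sub>w [F\<^sub>w : Q\<^sub>w] log max(1, |\<alpha>|\<^sub>w)\<close>, where \<open>F = Q(\<alpha>)\<close>, \<open>w\<close> runs over the places
  of \<open>F\<close>, and \<open>|\<cdot>|\<^sub>w\<close> is normalised to extend a normalised absolute value of the rationals.
  The local degrees are accounted for by summing over embeddings: composing the fixed
  extension of a rational place \<open>v\<close> with the \<open>[F : Q]\<close> embeddings of \<open>F\<close> into the algebraic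
  closure yields each place \<open>w\<close> above \<open>v\<close> exactly \<open>[F\<^sub>w : Q\<^sub>w]\<close> times. These embeddings
  correspond to the conjugates of \<open>\<alpha>\<close>. For each \<open>\<alpha>\<close> only finitely many \<open>v\<close> contribute.
\<close>

definition weil_height :: "qbar \<Rightarrow> real" where
  "weil_height \<alpha> =
     (1 / real (card (conjugates \<alpha>))) *
     (\<Sum>\<^sub>\<infinity>v\<in>places_Q. \<Sum>\<beta>\<in>conjugates \<alpha>. ln (max 1 (place_ext v \<beta>)))"


subsection \<open>The quantities attached to a subfield\<close>

definition div_closure :: "qbar set \<Rightarrow> qbar set" where
  "div_closure K = {\<gamma>. \<gamma> \<noteq> 0 \<and> (\<exists>m::int. m \<noteq> 0 \<and> \<gamma> powi m \<in> K - {0})}"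

text \<open>
  Both families of real numbers are bounded: the heights are nonnegative, and
  \<open>h(\<sigma>\<alpha>/\<alpha>) \<le> 2 h(\<alpha>)\<close>. So \<open>Inf\<close> and \<open>Sup\<close> on the reals are the genuine infimum and supremum.
\<close>

definition V_height :: "qbar set \<Rightarrow> qbar \<Rightarrow> real" where
  "V_height K \<alpha> = (INF \<gamma>\<in>div_closure K. weil_height (\<alpha> / \<gamma>))"

definition W_height :: "qbar set \<Rightarrow> qbar \<Rightarrow> real" where
  "W_height K \<alpha> = (SUP \<sigma>\<in>Aut_over K. weil_height (\<sigma> \<alpha> / \<alpha>))"

end

theory Submission
  imports Defs "HOL-Library.Product_Plus"
begin

text \<open>
  The height \<open>h\<close> on \<open>qbar\<close> is Galois invariant, subadditive under multiplication, satisfies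
  \<open>h(\<alpha>\<^sup>n) = n h(\<alpha>)\<close> and \<open>h(1/\<alpha>) = h(\<alpha>)\<close>, and vanishes on roots of unity.
  For \<open>\<gamma> \<in> div_closure K\<close> the quotient \<open>\<sigma>\<gamma>/\<gamma>\<close> is a root of unity, and
  \<open>\<sigma>\<alpha>/\<alpha> = (\<sigma>(\<alpha>/\<gamma>) / (\<alpha>/\<gamma>)) (\<sigma>\<gamma>/\<gamma>)\<close> gives \<open>W \<le> 2 V\<close>. Conversely, if the
  conjugates of \<open>\<alpha>\<close> over \<open>K\<close> are \<open>\<alpha>\<^sub>1, \<dots>, \<alpha>\<^sub>n\<close> and \<open>\<gamma>\<^sup>n\<close> is their product, then
  \<open>n h(\<alpha>/\<gamma>) = h(\<Prod> \<alpha>/\<alpha>\<^sub>i) \<le> \<Sum> h(\<alpha>\<^sub>i/\<alpha>) \<le> n W\<close>.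

  Two facts about \<open>qbar\<close> carry this. Automorphisms and the embedding into the complex numbers come
  from extending homomorphisms by Zorn's lemma. The \<open>p\<close>-adic absolute values extend because a
  subring that is maximal among those not containing \<open>1/p\<close> is a valuation ring whose value group
  is torsion over \<open>\<int>\<close>.
\<close>

subsection \<open>Subrings and polynomial extensions\<close>

text \<open>With a ring structure on pairs, a partial homomorphism is a subring of a product of fields, and
  extending it by one value is an adjunction.\<close>

instantiation prod :: (comm_ring_1, comm_ring_1) comm_ring_1
begin

definition one_prod_def: "1 = (1, 1)"
definition times_prod_def: "x * y = (fst x * fst y, snd x * snd y)"

instance
  by standard (auto simp: one_prod_def times_prod_def prod_eq_iff algebra_simps)

end

lemma fst_one [simp]: "fst 1 = 1" and snd_one [simp]: "snd 1 = 1"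
  by (simp_all add: one_prod_def)

lemma fst_times [simp]: "fst (x * y) = fst x * fst y"
  and snd_times [simp]: "snd (x * y) = snd x * snd y"
  by (simp_all add: times_prod_def)

lemma fst_of_int [simp]: "fst (of_int n) = of_int n"
  and snd_of_int [simp]: "snd (of_int n) = of_int n"
proof -
  have *: "fst (of_nat k) = of_nat k" "snd (of_nat k) = of_nat k" for k
    by (induction k) auto
  show "fst (of_int n) = of_int n"
    by (cases n rule: int_cases2) (simp_all add: *)
  show "snd (of_int n) = of_int n"
    by (cases n rule: int_cases2) (simp_all add: *)
qed

lemma fst_poly: "fst (poly p x) = poly (map_poly fst p) (fst x)"
  by (induction p) (auto simp: map_poly_pCons)

lemma snd_poly: "snd (poly p x) = poly (map_poly snd p) (snd x)"
  by (induction p) (auto simp: map_poly_pCons)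

definition is_subring :: "'a::comm_ring_1 set \<Rightarrow> bool" where
  "is_subring A \<longleftrightarrow> 1 \<in> A \<and> (\<forall>x\<in>A. \<forall>y\<in>A. x - y \<in> A \<and> x * y \<in> A)"

lemma is_subringD:
  assumes "is_subring A"
  shows "0 \<in> A" "1 \<in> A" "x \<in> A \<Longrightarrow> - x \<in> A"
    and "x \<in> A \<Longrightarrow> y \<in> A \<Longrightarrow> x - y \<in> A"
    and "x \<in> A \<Longrightarrow> y \<in> A \<Longrightarrow> x + y \<in> A"
    and "x \<in> A \<Longrightarrow> y \<in> A \<Longrightarrow> x * y \<in> A"
proof -
  show z: "0 \<in> A" using assms unfolding is_subring_def by (metis diff_self)
  show "1 \<in> A" using assms by (simp add: is_subring_def)
  show m: "x \<in> A \<Longrightarrow> - x \<in> A" for x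
    using assms z unfolding is_subring_def by (metis diff_0)
  show "x \<in> A \<Longrightarrow> y \<in> A \<Longrightarrow> x - y \<in> A"
    using assms by (simp add: is_subring_def)
  show "x \<in> A \<Longrightarrow> y \<in> A \<Longrightarrow> x + y \<in> A"
    using assms m unfolding is_subring_def by (metis diff_minus_eq_add)
  show "x \<in> A \<Longrightarrow> y \<in> A \<Longrightarrow> x * y \<in> A"
    using assms by (simp add: is_subring_def)
qed

lemma is_subring_power: "is_subring A \<Longrightarrow> x \<in> A \<Longrightarrow> x ^ n \<in> A"
  by (induction n) (auto intro: is_subringD)

lemma is_subring_sum: "is_subring A \<Longrightarrow> (\<And>i. i \<in> I \<Longrightarrow> f i \<in> A) \<Longrightarrow> sum f I \<in> A"
  by (induction I rule: infinite_finite_induct) (auto intro: is_subringD)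

lemma is_subring_of_int: "is_subring A \<Longrightarrow> of_int n \<in> A"
proof -
  assume A: "is_subring A"
  have *: "of_nat k \<in> A" for k
    by (induction k) (simp_all add: is_subringD[OF A])
  show ?thesis
    by (cases n rule: int_cases2) (simp_all add: * is_subringD(3)[OF A])
qed

lemma is_subring_chain_Union:
  assumes "C \<noteq> {}" "\<And>A. A \<in> C \<Longrightarrow> is_subring A"
    and chain: "\<And>A B. A \<in> C \<Longrightarrow> B \<in> C \<Longrightarrow> A \<subseteq> B \<or> B \<subseteq> A"
  shows "is_subring (\<Union>C)"
  unfolding is_subring_def
proof (intro conjI ballI)
  show "1 \<in> \<Union>C" using assms(1) is_subringD(2)[OF assms(2)] by blast
next
  fix x y assume "x \<in> \<Union>C" "y \<in> \<Union>C"
  then obtain A where "A \<in> C" "x \<in> A" "y \<in> A" using chain by blast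
  then show "x - y \<in> \<Union>C" "x * y \<in> \<Union>C"
    using is_subringD(4,6)[OF assms(2)] by blast+
qed

definition polys_over :: "'a::comm_ring_1 set \<Rightarrow> 'a poly set" where
  "polys_over A = {p. \<forall>i. coeff p i \<in> A}"

lemma is_subring_polys_over:
  assumes A: "is_subring A"
  shows "is_subring (polys_over A)"
  by (auto simp: is_subring_def polys_over_def coeff_mult intro!: is_subringD[OF A] is_subring_sum[OF A])

lemma monom_in_polys_over: "is_subring A \<Longrightarrow> c \<in> A \<Longrightarrow> monom c n \<in> polys_over A"
  by (auto simp: polys_over_def is_subringD)

definition adjoin :: "'a::comm_ring_1 set \<Rightarrow> 'a \<Rightarrow> 'a set" where
  "adjoin A x = (\<lambda>p. poly p x) ` polys_over A"

lemma is_subring_adjoin: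
  assumes "is_subring A"
  shows "is_subring (adjoin A x)"
proof -
  note * = is_subringD[OF is_subring_polys_over[OF assms]]
  have "poly 1 x \<in> adjoin A x"
    unfolding adjoin_def by (rule imageI) (rule *)
  moreover have "poly p x - poly q x \<in> adjoin A x" "poly p x * poly q x \<in> adjoin A x"
    if "p \<in> polys_over A" "q \<in> polys_over A" for p q
    unfolding adjoin_def poly_diff[symmetric] poly_mult[symmetric]
    by (rule imageI, rule *, (rule that)+)+
  ultimately show ?thesis
    by (auto simp: is_subring_def adjoin_def)
qed

lemma adjoin_subset:
  assumes "is_subring A"
  shows "A \<subseteq> adjoin A x"
proof
  fix c assume "c \<in> A"
  then have "poly (monom c 0) x \<in> adjoin A x"
    unfolding adjoin_def by (intro imageI monom_in_polys_over assms)
  then show "c \<in> adjoin A x" by (simp add: monom_0)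
qed

lemma self_in_adjoin:
  assumes "is_subring A"
  shows "x \<in> adjoin A x"
proof -
  have "poly (monom 1 1) x \<in> adjoin A x"
    unfolding adjoin_def by (intro imageI monom_in_polys_over assms is_subringD)
  then show ?thesis by (simp add: poly_monom)
qed

text \<open>The coefficient ring may have zero divisors, as pairs do, so only a monic divisor is
  allowed. Each step of the induction cancels the leading term of \<open>f\<close> by a monomial
  multiple of \<open>m\<close>, which keeps all coefficients in \<open>A\<close>.\<close>

lemma monic_division:
  assumes A: "is_subring A" and m: "m \<in> polys_over A" "lead_coeff m = 1" "degree m > 0"
    and f: "f \<in> polys_over A"
  shows "\<exists>q\<in>polys_over A. \<exists>r\<in>polys_over A. f = q * m + r \<and> degree r < degree m"
  using f
proof (induction "degree f" arbitrary: f rule: less_induct)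
  case less
  note PA = is_subringD[OF is_subring_polys_over[OF A]]
  show ?case
  proof (cases "degree f < degree m")
    case True
    then show ?thesis using less.prems PA(1) by (intro bexI[of _ 0] bexI[of _ f]) auto
  next
    case False
    define k where "k = degree f - degree m"
    define t where "t = monom (lead_coeff f) k"
    have t: "t \<in> polys_over A"
      unfolding t_def by (rule monom_in_polys_over[OF A]) (use less.prems in \<open>simp add: polys_over_def\<close>)
    have f': "f - t * m \<in> polys_over A"
      by (intro PA less.prems t m)
    have k: "degree f = k + degree m" using False by (simp add: k_def)
    have "degree (t * m) \<le> degree f"
      using degree_mult_le[of t m] degree_monom_le[of "lead_coeff f" k] k by (simp add: t_def)
    then have "degree (f - t * m) \<le> degree f" by (intro degree_diff_le) auto
    moreover have "coeff (f - t * m) (degree f) = 0"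
      using m k by (simp add: t_def coeff_monom_mult)
    ultimately have "degree (f - t * m) < degree f"
      using False m(3) by (metis degree_0 leading_coeff_0_iff nat_less_le not_gr0 not_less_zero k add_is_0)
    from less.hyps[OF this f'] obtain q r where "q \<in> polys_over A" "r \<in> polys_over A"
      "f - t * m = q * m + r" "degree r < degree m" by blast
    then show ?thesis
      using PA(5)[of q t] t by (intro bexI[of _ "q + t"] bexI[of _ r]) (auto simp: algebra_simps)
  qed
qed

subsection \<open>Extending homomorphisms to an algebraic extension\<close>

text \<open>Closure under inverses is automatic for algebraic elements, since the rationals lie in the
  domain.\<close>

definition hom_graph :: "('a::field_char_0 \<times> 'b::field_char_0) set \<Rightarrow> bool" where
  "hom_graph G \<longleftrightarrow> is_subring G \<and> (\<forall>q. (of_rat q, of_rat q) \<in> G) \<and> (\<forall>y. (0, y) \<in> G \<longrightarrow> y = 0)"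

text \<open>Subtracting two pairs with the same first entry lands in the fibre over 0, which is
  trivial.\<close>

lemma hom_graph_functional:
  assumes "hom_graph G" "(x, y) \<in> G" "(x, z) \<in> G"
  shows "y = z"
proof -
  have sub: "is_subring G" using assms(1) by (simp add: hom_graph_def)
  have "(x, y) - (x, z) \<in> G" by (intro is_subringD[OF sub] assms)
  then have "(0, y - z) \<in> G" by simp
  then have "y - z = 0" using assms(1) unfolding hom_graph_def by blast
  then show ?thesis by simp
qed

text \<open>An integral equation c + z q(z) = 0 with c nonzero holds for the first entry. Evaluated
  at the pair it gives an element of \<open>G\<close> over 0, so it holds for the second entry too,
  and - q(z) / c is an inverse in both entries at once.\<close>

lemma hom_graph_inverse:
  assumes G: "hom_graph G" and z: "z \<in> G" "fst z \<noteq> 0" and alg: "algebraic (fst z)"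
  obtains t where "t \<in> G" "t * z = 1"
proof -
  have sub: "is_subring G" using G by (simp add: hom_graph_def)
  obtain p where p: "poly (map_poly of_int p) (fst z) = 0" "coeff p 0 \<noteq> 0"
    using algebraicE'_nonzero[OF alg z(2)] by metis
  obtain c q where pc: "p = pCons c q" by (cases p)
  with p have c: "c \<noteq> 0" by simp
  define s where "s = poly (map_poly of_int q) z"
  have "map_poly of_int q \<in> polys_over G"
    by (simp add: polys_over_def coeff_map_poly is_subring_of_int[OF sub])
  then have s: "s \<in> G"
    using is_subring_power[OF sub z(1)] is_subringD[OF sub]
    unfolding s_def poly_altdef by (intro is_subring_sum[OF sub]) (simp add: polys_over_def)
  define u where "u = of_int c + z * s"
  have "u \<in> G"
    unfolding u_def by (intro is_subringD[OF sub] is_subring_of_int[OF sub] s z(1))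
  moreover have "fst u = 0"
    using p(1) by (simp add: u_def s_def fst_poly pc map_poly_pCons map_poly_map_poly o_def)
  ultimately have u: "u = 0"
    using G by (cases u) (auto simp: hom_graph_def zero_prod_def)
  \<comment> \<open>Dividing by - c stays inside \<open>G\<close>, because \<open>G\<close> contains
    the diagonal copy of the rationals.\<close>
  define d :: "'a \<times> 'b" where "d = (of_rat (- 1 / of_int c), of_rat (- 1 / of_int c))"
  have "d * of_int c = - 1"
    using c by (auto simp: d_def prod_eq_iff of_rat_divide of_rat_minus)
  then have "(d * s) * z = 1"
    using u unfolding u_def unfolding add_eq_0_iff by (simp add: mult.assoc mult.commute[of s z])
  moreover have "d * s \<in> G"
    using G s is_subringD(6)[OF sub] by (simp add: hom_graph_def d_def)
  ultimately show ?thesis using that by blast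
qed

lemma algebraic_imp_monic:
  assumes "algebraic (x :: 'a::field_char_0)"
  obtains p :: "rat poly" where "lead_coeff p = 1" "poly (map_poly of_rat p) x = 0"
proof -
  obtain p where p: "poly (map_poly of_int p) x = 0" "p \<noteq> 0"
    using algebraicE'[OF assms] by metis
  define c where "c = (of_int (lead_coeff p) :: rat)"
  have c: "c \<noteq> 0" using p by (simp add: c_def)
  define q where "q = smult (inverse c) (map_poly of_int p)"
  have "map_poly of_rat q = smult (inverse (of_rat c)) (map_poly of_int p :: 'a poly)"
    by (rule poly_eqI) (simp add: q_def coeff_map_poly of_rat_mult of_rat_inverse)
  moreover have "lead_coeff q = 1"
    using c by (simp add: q_def c_def degree_map_poly coeff_map_poly)
  ultimately show ?thesis using that[of q] p by simp
qed

text \<open>The coefficients are kept as pairs: the first entries give a minimal polynomial of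
  \<open>x\<close> over the domain of the partial homomorphism, the second entries its image.
  Candidates exist because a rational polynomial embeds diagonally.\<close>

lemma hom_graph_minimal_poly:
  fixes G :: "('a::field_char_0 \<times> 'b::{alg_closed_field,field_char_0}) set"
  assumes G: "hom_graph G" and alg: "algebraic x"
  obtains m where "m \<in> polys_over G" "lead_coeff m = 1" "degree m > 0"
    "poly (map_poly fst m) x = 0"
    "\<And>p. p \<in> polys_over G \<Longrightarrow> lead_coeff p = 1 \<Longrightarrow> poly (map_poly fst p) x = 0 \<Longrightarrow> degree m \<le> degree p"
proof -
  define P where "P m \<longleftrightarrow> m \<in> polys_over G \<and> lead_coeff m = 1 \<and> poly (map_poly fst m) x = 0" for m
  obtain p :: "rat poly" where p: "lead_coeff p = 1" "poly (map_poly of_rat p) x = 0"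
    using algebraic_imp_monic[OF alg] .
  define \<delta> where "\<delta> q = (of_rat q :: 'a, of_rat q :: 'b)" for q
  have \<delta>0: "\<delta> 0 = 0" by (simp add: \<delta>_def zero_prod_def)
  have \<delta>1: "\<delta> 1 = 1" by (simp add: \<delta>_def one_prod_def)
  have cf: "coeff (map_poly \<delta> p) i = \<delta> (coeff p i)" for i
    by (simp add: coeff_map_poly \<delta>0)
  have "degree (map_poly \<delta> p) = degree p"
    by (rule degree_map_poly) (auto simp: \<delta>_def zero_prod_def)
  then have "lead_coeff (map_poly \<delta> p) = 1" by (simp add: cf p(1) \<delta>1)
  moreover have "map_poly fst (map_poly \<delta> p) = map_poly of_rat p"
    by (rule poly_eqI) (simp add: coeff_map_poly cf, simp add: \<delta>_def)
  moreover have "map_poly \<delta> p \<in> polys_over G"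
    using G by (simp add: polys_over_def cf hom_graph_def \<delta>_def)
  ultimately have "P (map_poly \<delta> p)" using p by (simp add: P_def)
  then obtain m where m: "P m" "\<And>q. P q \<Longrightarrow> degree m \<le> degree q"
    using ex_has_least_nat[of P _ degree] by blast
  have "degree m > 0"
  proof (rule ccontr)
    assume "\<not> degree m > 0"
    then obtain c where "m = [:c:]" by (metis degree_eq_zeroE not_gr_zero)
    then show False using m(1) by (auto simp: P_def map_poly_pCons)
  qed
  then show ?thesis using that[of m] m unfolding P_def by blast
qed

text \<open>Sending \<open>x\<close> to a root of the transported minimal polynomial is consistent:
  if a polynomial over \<open>G\<close> vanishes at \<open>x\<close>, its remainder modulo
  \<open>m\<close> does as well, and a nonzero remainder could be made monic and would contradict
  minimality. Hence it also vanishes at \<open>y\<close>.\<close>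

lemma hom_graph_adjoin:
  fixes G :: "('a::field_char_0 \<times> 'b::{alg_closed_field,field_char_0}) set"
  assumes G: "hom_graph G" and alg: "\<And>x::'a. algebraic x"
    and m: "m \<in> polys_over G" "lead_coeff m = 1" "degree m > 0" "poly (map_poly fst m) x = 0"
    and min: "\<And>p. p \<in> polys_over G \<Longrightarrow> lead_coeff p = 1 \<Longrightarrow> poly (map_poly fst p) x = 0 \<Longrightarrow> degree m \<le> degree p"
    and y: "poly (map_poly snd m) y = 0"
  shows "hom_graph (adjoin G (x, y))"
proof -
  have sub: "is_subring G" using G by (simp add: hom_graph_def)
  have m0: "poly m (x, y) = 0" using m(4) y by (simp add: prod_eq_iff fst_poly snd_poly)
  have "w = 0" if w: "(0, w) \<in> adjoin G (x, y)" for w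
  proof -
    obtain f where f: "f \<in> polys_over G" "poly f (x, y) = (0, w)"
      using w unfolding adjoin_def by force
    obtain q r where qr: "q \<in> polys_over G" "r \<in> polys_over G" "f = q * m + r" "degree r < degree m"
      using monic_division[OF sub m(1-3) f(1)] by blast
    have r: "poly r (x, y) = (0, w)" using f qr m0 by simp
    have "r = 0"
    proof (rule ccontr)
      assume "r \<noteq> 0"
      have lc: "lead_coeff r \<in> G" using qr by (simp add: polys_over_def)
      moreover have "fst (lead_coeff r) \<noteq> 0"
      proof
        assume "fst (lead_coeff r) = 0"
        then have "lead_coeff r = 0"
          using lc G by (cases "lead_coeff r") (auto simp: hom_graph_def zero_prod_def)
        with \<open>r \<noteq> 0\<close> show False by simp
      qed
      ultimately obtain t where t: "t \<in> G" "t * lead_coeff r = 1"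
        using hom_graph_inverse[OF G _ _ alg] by blast
      \<comment> \<open>Over pairs, scaling by a nonzero constant could lower the degree; here the
        leading coefficient becomes 1.\<close>
      have d: "degree (smult t r) = degree r"
        using t(2) by (intro antisym degree_smult_le le_degree) simp
      have "smult t r \<in> polys_over G"
        using qr(2) t(1) by (simp add: polys_over_def is_subringD(6)[OF sub])
      moreover have "lead_coeff (smult t r) = 1" using t(2) d by simp
      moreover have "poly (map_poly fst (smult t r)) x = 0"
        using r fst_poly[of "smult t r" "(x, y)"] by simp
      ultimately show False using min d qr(4) by fastforce
    qed
    then show "w = 0" using r by (simp add: zero_prod_def)
  qed
  then show ?thesis
    using G is_subring_adjoin[OF sub] adjoin_subset[OF sub] unfolding hom_graph_def by blast
qed

definition is_ring_hom :: "('a::ring_1 \<Rightarrow> 'b::ring_1) \<Rightarrow> bool" where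
  "is_ring_hom f \<longleftrightarrow> f 1 = 1 \<and> (\<forall>x y. f (x + y) = f x + f y \<and> f (x * y) = f x * f y)"

text \<open>A partial homomorphism that is maximal by Zorn's lemma is total, since otherwise one
  more value could be adjoined. Only the codomain has to be algebraically closed.\<close>

theorem hom_graph_extends:
  fixes G :: "('a::field_char_0 \<times> 'b::{alg_closed_field,field_char_0}) set"
  assumes G: "hom_graph G" and alg: "\<And>x::'a. algebraic x"
  obtains f where "is_ring_hom f" "\<And>x y. (x, y) \<in> G \<Longrightarrow> f x = y"
proof -
  define S where "S = {H. hom_graph H \<and> G \<subseteq> H}"
  have "\<exists>M\<in>S. \<forall>H\<in>S. M \<subseteq> H \<longrightarrow> H = M"
  proof (rule subset_Zorn_nonempty)
    show "S \<noteq> {}" using G by (auto simp: S_def)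
    fix C assume C: "C \<noteq> {}" "subset.chain S C"
    have "is_subring (\<Union>C)"
    proof (rule is_subring_chain_Union[OF C(1)])
      show "\<And>A. A \<in> C \<Longrightarrow> is_subring A"
        using C(2) by (auto simp: subset.chain_def S_def hom_graph_def)
      show "\<And>A B. A \<in> C \<Longrightarrow> B \<in> C \<Longrightarrow> A \<subseteq> B \<or> B \<subseteq> A"
        using C(2) by (auto simp: subset_chain_def)
    qed
    moreover obtain A where "A \<in> C" using C(1) by blast
    moreover have "hom_graph B \<and> G \<subseteq> B" if "B \<in> C" for B
      using C(2) that by (auto simp: subset_chain_def S_def)
    ultimately show "\<Union>C \<in> S"
      unfolding S_def hom_graph_def by blast
  qed
  then obtain M where "M \<in> S" and max: "\<And>H. H \<in> S \<Longrightarrow> M \<subseteq> H \<Longrightarrow> H = M"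
    by blast
  then have M: "hom_graph M" "G \<subseteq> M" by (auto simp: S_def)
  have sub: "is_subring M" using M by (simp add: hom_graph_def)
  have "\<exists>y. (x, y) \<in> M" for x
  proof -
    obtain m where m: "m \<in> polys_over M" "lead_coeff m = 1" "degree m > 0" "poly (map_poly fst m) x = 0"
      "\<And>p. p \<in> polys_over M \<Longrightarrow> lead_coeff p = 1 \<Longrightarrow> poly (map_poly fst p) x = 0 \<Longrightarrow> degree m \<le> degree p"
      using hom_graph_minimal_poly[OF M(1) alg] by metis
    \<comment> \<open>The leading coefficient of \<open>m\<close> is the pair (1, 1), so the second
      entries also form a monic polynomial of positive degree, which has a root.\<close>
    have "degree (map_poly snd m) > 0"
      using m(2,3) le_degree[of "map_poly snd m" "degree m"] by (simp add: coeff_map_poly)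
    then obtain y where y: "poly (map_poly snd m) y = 0"
      using alg_closed_imp_poly_has_root by blast
    have "hom_graph (adjoin M (x, y))" by (rule hom_graph_adjoin[OF M(1) alg m y])
    then have "adjoin M (x, y) \<in> S" using M(2) adjoin_subset[OF sub] by (force simp: S_def)
    then have "adjoin M (x, y) = M" using adjoin_subset[OF sub] max by blast
    then show ?thesis using self_in_adjoin[OF sub, of "(x, y)"] by auto
  qed
  then obtain f where f: "\<And>x. (x, f x) \<in> M" by metis
  have f_eq: "f x = y" if "(x, y) \<in> M" for x y
    using hom_graph_functional[OF M(1) f that] .
  have "is_ring_hom f"
    unfolding is_ring_hom_def
  proof (intro conjI allI)
    show "f 1 = 1" using f_eq is_subringD(2)[OF sub] by (simp add: one_prod_def)
    show "f (x + y) = f x + f y" for x y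
      using is_subringD(5)[OF sub f f] f_eq by fastforce
    show "f (x * y) = f x * f y" for x y
      using is_subringD(6)[OF sub f f] f_eq by (fastforce simp: times_prod_def)
  qed
  then show ?thesis
    by (rule that) (use f_eq M(2) in blast)
qed

subsection \<open>Automorphisms of the algebraic numbers\<close>

lemma is_ring_homD:
  assumes "is_ring_hom f"
  shows "f 0 = 0" "f 1 = 1" "f (x + y) = f x + f y" "f (x * y) = f x * f y" "f (- x) = - f x"
    "f (x - y) = f x - f y" "f (x ^ n) = f x ^ n" "f (sum g A) = (\<Sum>i\<in>A. f (g i))"
proof -
  have 1: "f 1 = 1" and a: "f (x + y) = f x + f y" and m: "f (x * y) = f x * f y" for x y
    using assms by (simp_all add: is_ring_hom_def)
  have z: "f 0 = 0" using a[of 0 0] by simp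
  have n: "f (- x) = - f x" for x using a[of x "- x"] z by (simp add: eq_neg_iff_add_eq_0 add.commute)
  show "f 0 = 0" "f 1 = 1" "f (x + y) = f x + f y" "f (x * y) = f x * f y" "f (- x) = - f x" for x y
    by fact+
  show "f (x - y) = f x - f y" for x y using a[of x "- y"] n by simp
  show "f (x ^ n) = f x ^ n" by (induction n) (simp_all add: 1 m)
  show "f (sum g A) = (\<Sum>i\<in>A. f (g i))"
    by (induction A rule: infinite_finite_induct) (simp_all add: z a)
qed

lemma is_ring_hom_prod:
  fixes f :: "'a::comm_ring_1 \<Rightarrow> 'b::comm_ring_1"
  assumes "is_ring_hom f"
  shows "f (prod g A) = (\<Prod>i\<in>A. f (g i))"
  by (induction A rule: infinite_finite_induct) (simp_all add: is_ring_homD[OF assms])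

lemma is_ring_hom_poly:
  fixes f :: "'a::comm_ring_1 \<Rightarrow> 'b::comm_ring_1"
  assumes "is_ring_hom f"
  shows "f (poly p x) = poly (map_poly f p) (f x)"
  by (induction p) (simp_all add: map_poly_pCons is_ring_homD[OF assms])

lemma is_ring_hom_eq_0_iff:
  fixes f :: "'a::field \<Rightarrow> 'b::field"
  assumes "is_ring_hom f"
  shows "f x = 0 \<longleftrightarrow> x = 0"
proof
  assume "f x = 0"
  show "x = 0"
  proof (rule ccontr)
    assume "x \<noteq> 0"
    then have "f x * f (inverse x) = 1"
      using is_ring_homD(2,4)[OF assms] by (metis right_inverse)
    with \<open>f x = 0\<close> show False by simp
  qed
qed (simp add: is_ring_homD[OF assms])

lemma is_ring_hom_inverse:
  fixes f :: "'a::field \<Rightarrow> 'b::field"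
  assumes "is_ring_hom f"
  shows "f (inverse x) = inverse (f x)"
proof (cases "x = 0")
  case False
  then have "f (inverse x) * f x = 1"
    using is_ring_homD(2,4)[OF assms] by (metis left_inverse)
  then show ?thesis by (metis inverse_unique mult.commute)
qed (simp add: is_ring_homD[OF assms])

lemma is_ring_hom_divide:
  fixes f :: "'a::field \<Rightarrow> 'b::field"
  assumes "is_ring_hom f"
  shows "f (x / y) = f x / f y"
  by (simp add: divide_inverse is_ring_hom_inverse is_ring_homD assms)

lemma is_ring_hom_inj:
  fixes f :: "'a::field \<Rightarrow> 'b::field"
  assumes "is_ring_hom f"
  shows "inj f"
  using is_ring_hom_eq_0_iff[OF assms] is_ring_homD(6)[OF assms]
  by (metis injI right_minus_eq)

lemma is_ring_hom_of_rat:
  fixes f :: "'a::field_char_0 \<Rightarrow> 'b::field_char_0"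
  assumes "is_ring_hom f"
  shows "f (of_rat q) = of_rat q"
proof -
  have n: "f (of_nat k) = of_nat k" for k
    by (induction k) (simp_all add: is_ring_homD[OF assms])
  have "f (of_int k) = of_int k" for k
    by (cases k rule: int_cases2) (simp_all add: n is_ring_homD[OF assms])
  then show ?thesis
    by (cases q) (simp add: of_rat_rat is_ring_hom_divide[OF assms])
qed

lemma to_ac_eq_of_rat: "to_ac q = of_rat q"
  by (cases q) (simp add: of_rat_rat Fract_of_int_quotient of_rat_divide)

lemma algebraic_qbar: "algebraic (x :: qbar)"
proof -
  obtain p where p: "p \<noteq> 0" "poly (map_poly to_ac p) x = 0"
    by (rule alg_closure_algebraic)
  show ?thesis
  proof (rule algebraicI')
    show "coeff (map_poly to_ac p) i \<in> \<rat>" for i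
      by (simp add: coeff_map_poly to_ac_eq_of_rat)
    show "map_poly to_ac p \<noteq> 0"
      using p(1) by (metis map_poly_eq_0_iff to_ac_0 to_ac_eq_0_iff)
  qed (fact p(2))
qed

lemma rational_diagonal_hom_graph:
  "hom_graph (range (\<lambda>q. (of_rat q :: 'a::field_char_0, of_rat q :: 'b::field_char_0)))"
proof -
  have "is_subring (range (\<lambda>q. (of_rat q :: 'a, of_rat q :: 'b)))"
    unfolding is_subring_def
    by (auto simp: one_prod_def times_prod_def simp flip: of_rat_diff of_rat_mult)
  then show ?thesis by (auto simp: hom_graph_def)
qed

lemma qbar_embedding:
  obtains f :: "qbar \<Rightarrow> complex" where "is_ring_hom f"
  using hom_graph_extends[OF rational_diagonal_hom_graph algebraic_qbar] by metis

lemma Aut_over_iff: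
  "\<sigma> \<in> Aut_over K \<longleftrightarrow> is_ring_hom \<sigma> \<and> bij \<sigma> \<and> (\<forall>x\<in>K. \<sigma> x = x)"
  by (auto simp: Aut_over_def ring_iso_def ring_hom_def ring_of_type_algebra_def is_ring_hom_def)

text \<open>This leaves the record-based algebra: the rest of the argument sees \<open>K\<close>
  only as a subring containing the rationals.\<close>

lemma subfield_Qbar_ringD:
  assumes "subfield K Qbar_ring"
  shows "is_subring K" "of_rat q \<in> K"
proof -
  have sr: "subring K Qbar_ring" and un: "Units (Qbar_ring\<lparr>carrier := K\<rparr>) = K - {\<zero>\<^bsub>Qbar_ring\<^esub>}"
    using assms by (auto simp: subfield_def subfield_axioms_def subcring_def subdomain_def)
  note E = subringE[OF sr, unfolded ring_of_type_algebra_def, simplified]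
  have m: "- 1 \<in> K"
  proof -
    have "\<ominus>\<^bsub>Qbar_ring\<^esub> \<one>\<^bsub>Qbar_ring\<^esub> \<in> K" using subringE(3,5)[OF sr] by blast
    moreover have "\<ominus>\<^bsub>Qbar_ring\<^esub> \<one>\<^bsub>Qbar_ring\<^esub> = - 1"
    proof -
      interpret ring "Qbar_ring" by (rule ring_from_type_algebra)
      show ?thesis
        by (rule minus_equality) (auto simp: ring_of_type_algebra_def)
    qed
    ultimately show ?thesis by simp
  qed
  have minus: "- x \<in> K" if "x \<in> K" for x
    using E(6)[OF m that] by simp
  show sub: "is_subring K"
    unfolding is_subring_def using E(3,6) E(7)[OF _ minus] by auto
  have inv: "inverse x \<in> K" if "x \<in> K" for x
  proof (cases "x = 0")
    case False
    then have "x \<in> Units (Qbar_ring\<lparr>carrier := K\<rparr>)"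
      using un that by (simp add: ring_of_type_algebra_def)
    then obtain y where "y \<in> K" "y * x = 1"
      by (auto simp: Units_def ring_of_type_algebra_def)
    then show ?thesis by (metis inverse_unique mult.commute)
  qed (use that in simp)
  have "of_int a / of_int b \<in> K" for a b
    unfolding divide_inverse by (intro is_subringD[OF sub] inv is_subring_of_int[OF sub])
  then show "of_rat q \<in> K"
    by (cases q) (simp add: of_rat_rat)
qed

text \<open>Homomorphisms fix rational coefficients, so a single polynomial serves all images of
  \<open>x\<close>. It bounds their number and later makes them integral at almost all
  places.\<close>

lemma conjugate_rational_root:
  fixes x :: qbar
  obtains p :: "rat poly" where "lead_coeff p = 1"
    "\<And>f :: qbar \<Rightarrow> qbar. is_ring_hom f \<Longrightarrow> poly (map_poly of_rat p) (f x) = 0"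
proof -
  obtain p :: "rat poly" where p: "lead_coeff p = 1" "poly (map_poly of_rat p) x = 0"
    using algebraic_imp_monic[OF algebraic_qbar] .
  have "poly (map_poly of_rat p) (f x) = 0" if f: "is_ring_hom f" for f :: "qbar \<Rightarrow> qbar"
  proof -
    have "map_poly f (map_poly of_rat p) = map_poly of_rat p"
      by (rule poly_eqI) (simp add: coeff_map_poly is_ring_homD[OF f] is_ring_hom_of_rat[OF f])
    then show ?thesis
      using is_ring_hom_poly[OF f, of "map_poly of_rat p" x] p is_ring_homD(1)[OF f] by simp
  qed
  with p(1) that show ?thesis by blast
qed

lemma finite_ring_hom_images: "finite {f x | f. is_ring_hom (f :: qbar \<Rightarrow> qbar)}"
proof -
  obtain p :: "rat poly" where p: "lead_coeff p = 1"
    "\<And>f :: qbar \<Rightarrow> qbar. is_ring_hom f \<Longrightarrow> poly (map_poly of_rat p) (f x) = 0"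
    using conjugate_rational_root by blast
  have "map_poly of_rat p \<noteq> (0 :: qbar poly)"
    using p(1) by (auto simp: map_poly_eq_0_iff)
  then have "finite {y :: qbar. poly (map_poly of_rat p) y = 0}"
    by (rule poly_roots_finite)
  then show ?thesis by (rule rev_finite_subset) (use p(2) in auto)
qed

lemma is_ring_hom_comp: "is_ring_hom f \<Longrightarrow> is_ring_hom g \<Longrightarrow> is_ring_hom (f \<circ> g)"
  by (simp add: is_ring_hom_def)

text \<open>For each \<open>x\<close>, the finite set of images of \<open>x\<close> under all
  endomorphisms is mapped injectively into itself by \<open>f\<close>, hence onto itself, and it
  contains \<open>x\<close>.\<close>

lemma qbar_endomorphism_bij:
  fixes f :: "qbar \<Rightarrow> qbar"
  assumes "is_ring_hom f"
  shows "bij f"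
proof -
  have "x \<in> range f" for x
  proof -
    define S where "S = {g x | g. is_ring_hom (g :: qbar \<Rightarrow> qbar)}"
    have "finite S" unfolding S_def by (rule finite_ring_hom_images)
    moreover have "f ` S \<subseteq> S"
    proof
      fix y assume "y \<in> f ` S"
      then obtain g where "is_ring_hom g" "y = (f \<circ> g) x" by (auto simp: S_def)
      then show "y \<in> S" unfolding S_def using is_ring_hom_comp[OF assms] by blast
    qed
    moreover have "inj_on f S" using is_ring_hom_inj[OF assms] by (rule inj_on_subset) simp
    ultimately have "f ` S = S" by (rule endo_inj_surj)
    moreover have "x \<in> S" unfolding S_def
      by (rule CollectI, rule exI[of _ id]) (simp add: is_ring_hom_def)
    ultimately show ?thesis by blast
  qed
  then show ?thesis using is_ring_hom_inj[OF assms] by (auto simp: bij_def)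
qed

lemma Aut_over_id: "id \<in> Aut_over K"
  by (simp add: Aut_over_iff is_ring_hom_def)

lemma Aut_over_comp: "\<sigma> \<in> Aut_over K \<Longrightarrow> \<tau> \<in> Aut_over K \<Longrightarrow> \<sigma> \<circ> \<tau> \<in> Aut_over K"
  by (simp add: Aut_over_iff is_ring_hom_comp bij_comp)

lemma Aut_over_inv:
  assumes "\<sigma> \<in> Aut_over K"
  shows "inv_into UNIV \<sigma> \<in> Aut_over K"
proof -
  have \<sigma>: "is_ring_hom \<sigma>" "bij \<sigma>" "\<forall>x\<in>K. \<sigma> x = x" using assms by (auto simp: Aut_over_iff)
  have i: "inv_into UNIV \<sigma> y = x" if "\<sigma> x = y" for x y
    using \<sigma>(2) that by (metis bij_inv_eq_iff)
  have s: "\<sigma> (inv_into UNIV \<sigma> y) = y" for y using \<sigma>(2) by (simp add: bij_is_surj surj_f_inv_f)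
  have "is_ring_hom (inv_into UNIV \<sigma>)"
    unfolding is_ring_hom_def by (intro conjI allI i) (simp_all add: s is_ring_homD[OF \<sigma>(1)])
  moreover have "inv_into UNIV \<sigma> x = x" if "x \<in> K" for x
    using \<sigma>(3) that by (intro i) simp
  ultimately show ?thesis using \<sigma>(2) by (simp add: Aut_over_iff bij_imp_bij_inv)
qed

text \<open>Over an algebraically closed field such a polynomial is a power of X - x. The induction
  splits off one linear factor at a time and tracks the second highest coefficient.\<close>

lemma monic_single_root_coeff:
  fixes p :: "'a::alg_closed_field poly"
  assumes "degree p = Suc n" "lead_coeff p = 1" "\<And>y. poly p y = 0 \<Longrightarrow> y = x"
  shows "coeff p n = - of_nat (Suc n) * x"
  using assms
proof (induction n arbitrary: p)
  case (0 p)
  obtain y where y: "poly p y = 0" using alg_closed_imp_poly_has_root[of p] 0(1) by auto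
  have "poly p y = coeff p 0 + coeff p 1 * y" using 0(1) by (simp add: poly_altdef)
  moreover have "y = x" "coeff p 1 = 1" using y 0 by simp_all
  ultimately show ?case using y by (simp add: eq_neg_iff_add_eq_0)
next
  case (Suc n p)
  obtain y where y: "poly p y = 0" using alg_closed_imp_poly_has_root[of p] Suc.prems(1) by auto
  then have "poly p x = 0" using Suc.prems(3) by blast
  then obtain q where q: "p = [:- x, 1:] * q" by (metis dvdE poly_eq_0_iff_dvd)
  have "q \<noteq> 0" using Suc.prems(1) q by auto
  have "degree p = degree [:- x, 1:] + degree q"
    unfolding q by (rule degree_mult_eq) (use \<open>q \<noteq> 0\<close> in auto)
  then have d: "degree q = Suc n" using Suc.prems(1) by simp
  have "lead_coeff p = lead_coeff [:- x, 1:] * lead_coeff q"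
    unfolding q by (rule lead_coeff_mult)
  then have l: "lead_coeff q = 1" using Suc.prems(2) by simp
  have "poly q z = 0 \<Longrightarrow> z = x" for z using Suc.prems(3) q by simp
  then have IH: "coeff q n = - of_nat (Suc n) * x" using Suc.IH d l by blast
  have "coeff p (Suc n) = coeff q n - x * coeff q (Suc n)"
    by (simp add: q)
  also have "\<dots> = - of_nat (Suc n) * x - x" using IH d l by simp
  also have "\<dots> = - of_nat (Suc (Suc n)) * x" by (simp add: algebra_simps)
  finally show ?case .
qed

text \<open>A minimal polynomial of \<open>x\<close> over \<open>K\<close> has a root \<open>y\<close> other than \<open>x\<close>, because otherwise its second
  coefficient \<open>- n x\<close> would put \<open>x\<close> into \<open>K\<close>; then map \<open>x\<close> to \<open>y\<close>.\<close>

theorem Aut_over_fixed_field: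
  assumes K: "is_subring K" "\<And>q. of_rat q \<in> K" and x: "x \<notin> K"
  obtains \<sigma> where "\<sigma> \<in> Aut_over K" "\<sigma> x \<noteq> x"
proof -
  \<comment> \<open>The graph of the identity on \<open>K\<close>. The two entries of every
    coefficient over it agree, so the transported minimal polynomial is \<open>p\<close> itself and
    any root of \<open>p\<close> may serve as the image of \<open>x\<close>.\<close>
  define G where "G = (\<lambda>k. (k, k)) ` K"
  have G: "hom_graph G"
    using is_subringD(2,4,6)[OF K(1)] K(2)
    by (simp add: hom_graph_def is_subring_def G_def one_prod_def times_prod_def image_iff)
  obtain m where m: "m \<in> polys_over G" "lead_coeff m = 1" "degree m > 0" "poly (map_poly fst m) x = 0"
    "\<And>p. p \<in> polys_over G \<Longrightarrow> lead_coeff p = 1 \<Longrightarrow> poly (map_poly fst p) x = 0 \<Longrightarrow> degree m \<le> degree p"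
    using hom_graph_minimal_poly[OF G algebraic_qbar] by metis
  define p where "p = map_poly fst m"
  have cm: "coeff m i \<in> G" for i using m(1) by (simp add: polys_over_def)
  have p': "map_poly snd m = p"
  proof (rule poly_eqI)
    show "coeff (map_poly snd m) i = coeff p i" for i
      using cm[of i] by (auto simp: p_def coeff_map_poly G_def)
  qed
  have pK: "coeff p i \<in> K" for i
    using cm[of i] by (auto simp: p_def coeff_map_poly G_def)
  have dp: "degree p = degree m"
    unfolding p_def using m(2) by (intro map_poly_degree_eq) simp
  then obtain n where n: "degree p = Suc n" using m(3) by (metis gr0_implies_Suc)
  have lp: "lead_coeff p = 1" using dp m(2) by (simp add: p_def coeff_map_poly)
  obtain y where y: "poly p y = 0" "y \<noteq> x"
  proof -
    have "\<exists>y. poly p y = 0 \<and> y \<noteq> x"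
    proof (rule ccontr)
      assume "\<not> ?thesis"
      then have c: "coeff p n = - of_nat (Suc n) * x"
        by (intro monic_single_root_coeff n lp) blast
      have "x = of_rat (- 1 / of_nat (Suc n)) * coeff p n"
        unfolding c by (simp add: of_rat_divide of_rat_minus del: of_nat_Suc)
      then have "x \<in> K" using is_subringD(6)[OF K(1) K(2) pK] by metis
      with x show False by simp
    qed
    then show ?thesis using that by blast
  qed
  have "hom_graph (adjoin G (x, y))"
    by (rule hom_graph_adjoin[OF G algebraic_qbar m]) (use y p' in auto)
  then obtain \<sigma> where \<sigma>: "is_ring_hom \<sigma>" "\<And>a b. (a, b) \<in> adjoin G (x, y) \<Longrightarrow> \<sigma> a = b"
    using hom_graph_extends[OF _ algebraic_qbar] by metis
  have sub: "is_subring G" using G by (simp add: hom_graph_def)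
  have "\<sigma> x = y" using \<sigma>(2) self_in_adjoin[OF sub] by blast
  moreover have "\<sigma> k = k" if "k \<in> K" for k
    using adjoin_subset[OF sub] that by (intro \<sigma>(2)) (auto simp: G_def)
  ultimately show ?thesis
    using y(2) \<sigma>(1) qbar_endomorphism_bij by (intro that[of \<sigma>]) (auto simp: Aut_over_iff)
qed

section \<open>Galois orbits and norms\<close>

definition orbit :: "qbar set \<Rightarrow> qbar \<Rightarrow> qbar set" where
  "orbit K x = (\<lambda>\<sigma>. \<sigma> x) ` Aut_over K"

lemma finite_orbit: "finite (orbit K x)"
  by (rule finite_subset[OF _ finite_ring_hom_images[of x]]) (auto simp: orbit_def Aut_over_iff)

lemma self_in_orbit: "x \<in> orbit K x"
  unfolding orbit_def using Aut_over_id by (intro image_eqI[of _ _ id]) auto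

lemma Aut_over_image_orbit:
  assumes "\<tau> \<in> Aut_over K"
  shows "\<tau> ` orbit K x = orbit K x"
proof (rule endo_inj_surj[OF finite_orbit])
  show "\<tau> ` orbit K x \<subseteq> orbit K x"
    unfolding orbit_def using Aut_over_comp[OF assms] by (auto intro!: image_eqI[of _ _ "\<tau> \<circ> _"])
  show "inj_on \<tau> (orbit K x)"
    using assms by (auto simp: Aut_over_iff bij_def intro: inj_on_subset)
qed

text \<open>Automorphisms permute the orbit and therefore fix its product, the norm of
  \<open>x\<close> over \<open>K\<close>; elements outside \<open>K\<close> are moved by some
  automorphism.\<close>

lemma prod_orbit_in_subfield:
  assumes K: "is_subring K" "\<And>q. of_rat q \<in> K"
  shows "\<Prod>(orbit K x) \<in> K"
proof (rule ccontr)
  assume "\<Prod>(orbit K x) \<notin> K"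
  then obtain \<sigma> where \<sigma>: "\<sigma> \<in> Aut_over K" "\<sigma> (\<Prod>(orbit K x)) \<noteq> \<Prod>(orbit K x)"
    using Aut_over_fixed_field[OF K] by blast
  have h: "is_ring_hom \<sigma>" and "bij \<sigma>" using \<sigma>(1) by (simp_all add: Aut_over_iff)
  then have "inj_on \<sigma> (orbit K x)" by (auto simp: bij_def intro: inj_on_subset)
  then have "\<Prod>(\<sigma> ` orbit K x) = \<sigma> (\<Prod>(orbit K x))"
    by (simp add: prod.reindex is_ring_hom_prod[OF h] o_def)
  with \<sigma> show False by (simp add: Aut_over_image_orbit)
qed

subsection \<open>Extending the places of the rationals\<close>

locale subring_avoiding_inverse =
  fixes A :: "'a::field_char_0 set" and c :: 'a
  assumes sub: "is_subring A" and c_in: "c \<in> A" and c_nz: "c \<noteq> 0" and c_inv: "inverse c \<notin> A"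
    and maximal: "\<And>B. is_subring B \<Longrightarrow> A \<subseteq> B \<Longrightarrow> inverse c \<notin> B \<Longrightarrow> B = A"
begin

text \<open>If the inverse of u = 1 - c b were missing from \<open>A\<close>, adjoining it would by
  maximality produce 1/c as a polynomial in 1/u. Clearing denominators makes some power of u
  divisible by c, while every power of u is 1 modulo c; so c would be invertible.\<close>

lemma one_minus_unit:
  assumes b: "b \<in> A"
  shows "1 - c * b \<noteq> 0" "inverse (1 - c * b) \<in> A"
proof -
  define u where "u = 1 - c * b"
  have no: "c * a \<noteq> 1" if "a \<in> A" for a
    using c_inv that by (metis inverse_unique)
  have "u \<in> A" unfolding u_def by (intro is_subringD[OF sub] b c_in)
  show u0: "1 - c * b \<noteq> 0" using no[OF b] by simp
  then have "u \<noteq> 0" by (simp add: u_def)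
  have un: "\<exists>a\<in>A. u ^ n = 1 - c * a" for n
  proof (induction n)
    case 0
    then show ?case by (intro bexI[of _ 0]) (simp_all add: is_subringD[OF sub])
  next
    case (Suc n)
    then obtain a where a: "a \<in> A" "u ^ n = 1 - c * a" by blast
    have "u ^ Suc n = u * (1 - c * a)" using a by simp
    also have "\<dots> = 1 - c * (a + b - c * a * b)"
      by (simp add: u_def algebra_simps)
    finally have "u ^ Suc n = 1 - c * (a + b - c * a * b)" .
    moreover have "a + b - c * a * b \<in> A" by (intro is_subringD[OF sub] a b c_in)
    ultimately show ?case by blast
  qed
  show "inverse (1 - c * b) \<in> A"
  proof (rule ccontr)
    assume "inverse (1 - c * b) \<notin> A"
    then have "adjoin A (inverse u) \<noteq> A" using self_in_adjoin[OF sub] u_def by metis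
    then have "inverse c \<in> adjoin A (inverse u)"
      using maximal is_subring_adjoin[OF sub] adjoin_subset[OF sub] by blast
    then obtain f where f: "f \<in> polys_over A" "inverse c = poly f (inverse u)"
      by (auto simp: adjoin_def)
    define n where "n = degree f"
    define a where "a = (\<Sum>i\<le>n. coeff f i * u ^ (n - i))"
    have aA: "a \<in> A" unfolding a_def
      using f(1) by (intro is_subring_sum[OF sub] is_subringD(6)[OF sub] is_subring_power[OF sub] \<open>u \<in> A\<close>)
        (simp add: polys_over_def)
    have "u ^ n * inverse c = (\<Sum>i\<le>n. coeff f i * (u ^ n * inverse u ^ i))"
      by (simp add: f(2) poly_altdef n_def sum_distrib_left mult_ac)
    also have "\<dots> = a"
      unfolding a_def
      by (intro sum.cong refl) (use \<open>u \<noteq> 0\<close> in \<open>simp add: power_diff field_simps\<close>)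
    finally have "u ^ n = c * a" using c_nz by (simp add: field_simps)
    moreover obtain a' where "a' \<in> A" "u ^ n = 1 - c * a'" using un by blast
    ultimately have "c * (a + a') = 1" by (simp add: algebra_simps)
    then show False using no is_subringD(5)[OF sub aA \<open>a' \<in> A\<close>] by blast
  qed
qed

text \<open>In the equation for 1/x the constant term is moved to the other side, where 1 - c g(0)
  is invertible. Multiplication by \<open>x ^ n\<close> then expresses \<open>x ^ n\<close> through
  lower powers, and this replaces the top term of \<open>f\<close>.\<close>

lemma reduce_degree:
  assumes "x \<noteq> 0" and f: "f \<in> polys_over A" "degree f \<le> n" "inverse c = poly f x"
    and g: "g \<in> polys_over A" "degree g \<le> n" "inverse c = poly g (inverse x)" and n: "n > 0"
  shows "\<exists>h\<in>polys_over A. degree h < n \<and> inverse c = poly h x"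
proof -
  note PA = is_subringD[OF is_subring_polys_over[OF sub]]
  have fA: "coeff f i \<in> A" and gA: "coeff g i \<in> A" for i
    using f(1) g(1) by (simp_all add: polys_over_def)
  define w where "w = inverse (1 - c * coeff g 0)"
  have w: "w \<in> A" "w * (1 - c * coeff g 0) = 1"
    using one_minus_unit[OF gA] by (simp_all add: w_def)
  \<comment> \<open>The coefficients of \<open>g\<close> in reversed order without the constant one,
    which is why the degree is at most n - 1.\<close>
  define h where "h = (\<Sum>j\<in>{1..n}. monom (w * coeff g j) (n - j))"
  have h: "h \<in> polys_over A" unfolding h_def
    by (intro is_subring_sum is_subring_polys_over sub monom_in_polys_over is_subringD w gA)
  have "degree h \<le> n - 1" unfolding h_def
    by (intro degree_sum_le order.trans[OF degree_monom_le]) auto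
  then have dh: "degree h < n" using n by simp
  have "inverse c = (\<Sum>j\<le>n. coeff g j * inverse x ^ j)"
    unfolding g(3) poly_altdef
    by (rule sum.mono_neutral_left) (use g(2) in \<open>auto simp: coeff_eq_0\<close>)
  also have "{..n} = insert 0 {1..n}" using n by auto
  finally have "1 - c * coeff g 0 = c * (\<Sum>j\<in>{1..n}. coeff g j * inverse x ^ j)"
    using c_nz by (simp add: field_simps)
  then have "1 = w * (c * (\<Sum>j\<in>{1..n}. coeff g j * inverse x ^ j))"
    using w(2) by simp
  then have "x ^ n = x ^ n * (w * (c * (\<Sum>j\<in>{1..n}. coeff g j * inverse x ^ j)))"
    by (metis mult_1_right)
  also have "\<dots> = c * (\<Sum>j\<in>{1..n}. w * coeff g j * (x ^ n * inverse x ^ j))"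
    by (simp add: sum_distrib_left mult_ac)
  also have "\<dots> = c * poly h x"
    unfolding h_def poly_sum poly_monom
    by (intro arg_cong[of _ _ "(*) c"] sum.cong refl)
      (use \<open>x \<noteq> 0\<close> in \<open>simp add: power_diff field_simps\<close>)
  finally have xn: "x ^ n = c * poly h x" .
  define f' where "f' = f - monom (coeff f n) n"
  define F where "F = f' + smult (coeff f n * c) h"
  have "smult (coeff f n * c) h \<in> polys_over A"
    using h by (simp add: polys_over_def is_subringD(6)[OF sub] c_in fA)
  then have "F \<in> polys_over A"
    unfolding F_def f'_def by (intro PA f monom_in_polys_over sub fA)
  moreover have "degree f' < n"
  proof -
    have "degree f' \<le> n" unfolding f'_def using f(2) degree_monom_le[of "coeff f n" n] by (intro degree_diff_le)
    moreover have "coeff f' n = 0" by (simp add: f'_def)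
    ultimately show ?thesis using n by (metis degree_0 leading_coeff_0_iff le_neq_implies_less)
  qed
  then have "degree F < n" unfolding F_def
    using dh degree_smult_le[of "coeff f n * c" h] by (intro degree_add_less) auto
  moreover have "poly F x = inverse c"
    using f(3) xn by (simp add: F_def f'_def poly_monom algebra_simps)
  ultimately show ?thesis by metis
qed

text \<open>If neither \<open>x\<close> nor \<open>1/x\<close> were in \<open>A\<close>, then \<open>1/c\<close> would be a polynomial in \<open>x\<close> and one in
  \<open>1/x\<close>; take both of minimal degree and reduce the larger one.\<close>

lemma valuation_ring: "x \<in> A \<or> inverse x \<in> A"
proof (rule ccontr)
  assume no: "\<not> ?thesis"
  define P where "P z n \<longleftrightarrow> (\<exists>f\<in>polys_over A. degree f \<le> n \<and> inverse c = poly f z)" for z n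
  have "x \<noteq> 0" using no is_subringD(1)[OF sub] by auto
  have ex: "\<exists>n. P z n" if "z \<notin> A" for z
  proof -
    have "inverse c \<in> adjoin A z"
      using that maximal[OF is_subring_adjoin[OF sub] adjoin_subset[OF sub]] self_in_adjoin[OF sub] by blast
    then show ?thesis unfolding P_def adjoin_def by auto
  qed
  have pos: "n > 0" if "P z n" for z n
  proof (rule ccontr)
    assume "\<not> n > 0"
    with that obtain f where f: "f \<in> polys_over A" "degree f = 0" "inverse c = poly f z"
      unfolding P_def by auto
    then have "inverse c = coeff f 0" by (simp add: poly_altdef)
    with f(1) c_inv show False by (simp add: polys_over_def)
  qed
  \<comment> \<open>Used with z = x and with z = 1/x, so that the larger of the two minimal degrees
    is contradicted in either case.\<close>
  have step: "\<exists>k<n. P z k" if "P z n" "P (inverse z) m" "m \<le> n" "z \<noteq> 0" for z n m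
    using reduce_degree[OF that(4), of _ n] that pos[OF that(1)] unfolding P_def
    by (meson order.trans order_refl)
  obtain n where n: "P x n" "\<And>k. k < n \<Longrightarrow> \<not> P x k"
    using ex no by (metis exists_least_iff)
  obtain m where m: "P (inverse x) m" "\<And>k. k < m \<Longrightarrow> \<not> P (inverse x) k"
    using ex no by (metis exists_least_iff)
  show False
  proof (cases "m \<le> n")
    case True
    then show False using step[OF n(1) m(1)] n(2) \<open>x \<noteq> 0\<close> by blast
  next
    case False
    then show False using step[OF m(1), of n] n(1) m(2) \<open>x \<noteq> 0\<close> by auto
  qed
qed

section \<open>Units and rational orders\<close>

definition unit :: "'a \<Rightarrow> bool" where
  "unit u \<longleftrightarrow> u \<noteq> 0 \<and> u \<in> A \<and> inverse u \<in> A"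

lemma unit_mult: "unit u \<Longrightarrow> unit v \<Longrightarrow> unit (u * v)"
  by (simp add: unit_def is_subringD[OF sub])

lemma unit_inverse: "unit u \<Longrightarrow> unit (inverse u)"
  by (simp add: unit_def)

lemma unit_divide: "unit u \<Longrightarrow> unit v \<Longrightarrow> unit (u / v)"
  by (simp add: divide_inverse unit_mult unit_inverse)

lemma unit_power: "unit u \<Longrightarrow> unit (u ^ n)"
  by (simp add: unit_def is_subring_power[OF sub] flip: power_inverse)

lemma not_unit_c:
  assumes "n > 0"
  shows "\<not> (a \<in> A \<and> c ^ n * a = 1)"
proof
  assume a: "a \<in> A \<and> c ^ n * a = 1"
  obtain m where "n = Suc m" using assms by (metis gr0_implies_Suc)
  then have "c * (c ^ m * a) = 1" using a by (simp add: mult_ac)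
  then have "inverse c = c ^ m * a" by (rule inverse_unique)
  then show False using a c_inv c_in by (simp add: is_subringD[OF sub] is_subring_power[OF sub])
qed

lemma unit_c_powi: "unit (c powi k) \<Longrightarrow> k = 0"
proof (rule ccontr)
  assume u: "unit (c powi k)" and "k \<noteq> 0"
  then have "nat \<bar>k\<bar> > 0" by simp
  note no = not_unit_c[OF this]
  show False
  proof (cases "k \<ge> 0")
    case True
    then show False using no[of "inverse (c powi k)"] u by (simp add: unit_def power_int_def)
  next
    case False
    then show False using no[of "c powi k"] u c_nz
      by (simp add: unit_def power_int_def flip: power_mult_distrib)
  qed
qed

text \<open>One of the two summands divides the other. If x divides y and the sum is a unit, then
  1/x = (1 + y/x) / (x + y) lies in \<open>A\<close>.\<close>

lemma nonunit_add:
  assumes "x \<in> A" "\<not> unit x" "y \<in> A" "\<not> unit y"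
  shows "\<not> unit (x + y)"
proof
  assume u: "unit (x + y)"
  have *: False if "x \<in> A" "\<not> unit x" "y \<in> A" "\<not> unit y" "unit (x + y)" "y / x \<in> A" for x y
  proof (cases "x = 0")
    case False
    then have "inverse x = (1 + y / x) * inverse (x + y)"
      using that(5) by (simp add: unit_def field_simps)
    also have "\<dots> \<in> A" using that(5,6)
      by (intro is_subringD[OF sub]) (auto simp: unit_def)
    finally show False using that False by (simp add: unit_def)
  qed (use that in auto)
  have "y / x \<in> A \<or> x / y \<in> A" using valuation_ring[of "x / y"] by auto
  then show False using *[of x y] *[of y x] assms u by (auto simp: add.commute)
qed

lemma nonunit_sum:
  "finite I \<Longrightarrow> (\<And>i. i \<in> I \<Longrightarrow> f i \<in> A \<and> \<not> unit (f i)) \<Longrightarrow> sum f I \<in> A \<and> \<not> unit (sum f I)"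
proof (induction I rule: finite_induct)
  case empty
  then show ?case by (simp add: unit_def is_subringD[OF sub])
next
  case (insert i I)
  then show ?case using nonunit_add is_subringD(5)[OF sub] by simp
qed

text \<open>Divisibility is total in a valuation ring; the chosen term is one of least order, found
  before orders are available.\<close>

lemma finite_divides_all:
  "finite I \<Longrightarrow> I \<noteq> {} \<Longrightarrow> (\<And>i. i \<in> I \<Longrightarrow> t i \<noteq> 0) \<Longrightarrow> \<exists>i\<in>I. \<forall>j\<in>I. t j / t i \<in> A"
proof (induction I rule: finite_ne_induct)
  case (singleton i)
  then show ?case by (simp add: is_subringD[OF sub])
next
  case (insert k I)
  then obtain i where i: "i \<in> I" "\<forall>j\<in>I. t j / t i \<in> A" by auto
  have nz: "t k \<noteq> 0" "t i \<noteq> 0" using insert.prems i by auto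
  show ?case
  proof (cases "t k / t i \<in> A")
    case True
    then show ?thesis using i by auto
  next
    case False
    then have ik: "t i / t k \<in> A" using valuation_ring[of "t k / t i"] by simp
    have "t j / t k \<in> A" if "j \<in> I" for j
    proof -
      have "t j / t k = (t j / t i) * (t i / t k)" using nz by simp
      then show ?thesis using i that ik is_subringD(6)[OF sub] by metis
    qed
    then show ?thesis using nz by (intro bexI[of _ k]) (auto simp: is_subringD[OF sub])
  qed
qed

text \<open>The valuation normalised to be 1 at \<open>c\<close>, without a value group: some power
  of \<open>x\<close> agrees with a power of \<open>c\<close> up to a unit, and \<open>r\<close> is
  the quotient of the exponents. It is a relation because existence uses algebraicity, which enters
  only later.\<close>

definition has_order :: "'a \<Rightarrow> real \<Rightarrow> bool" where
  "has_order x r \<longleftrightarrow> (\<exists>n k. n > 0 \<and> unit (x ^ n / c powi k) \<and> r = of_int k / of_nat n)"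

text \<open>Raising both equations to a common power of \<open>x\<close> and dividing leaves a power
  of \<open>c\<close> that is a unit, so its exponent is 0.\<close>

lemma has_order_unique:
  assumes "has_order x r" "has_order x s"
  shows "r = s"
proof -
  obtain n k where n: "n > 0" "unit (x ^ n / c powi k)" "r = of_int k / of_nat n"
    using assms(1) by (auto simp: has_order_def)
  obtain m l where m: "m > 0" "unit (x ^ m / c powi l)" "s = of_int l / of_nat m"
    using assms(2) by (auto simp: has_order_def)
  have "x \<noteq> 0" using n by (auto simp: unit_def)
  have "unit ((x ^ n / c powi k) ^ m / (x ^ m / c powi l) ^ n)"
    by (intro unit_divide unit_power n m)
  also have "(x ^ n / c powi k) ^ m / (x ^ m / c powi l) ^ n = c powi (l * int n - k * int m)"
    using \<open>x \<noteq> 0\<close> c_nz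
    by (simp add: power_divide power_int_diff power_int_mult flip: power_mult)
       (simp add: mult.commute)
  finally have "l * int n = k * int m" using unit_c_powi by force
  then have "real_of_int l * real n = real_of_int k * real m" by (metis of_int_mult of_int_of_nat_eq)
  then show ?thesis using n(1) m(1) by (simp add: n(3) m(3) frac_eq_eq)
qed

lemma has_order_mult:
  assumes "has_order x r" "has_order y s"
  shows "has_order (x * y) (r + s)"
proof -
  obtain n k where n: "n > 0" "unit (x ^ n / c powi k)" "r = of_int k / of_nat n"
    using assms(1) by (auto simp: has_order_def)
  obtain m l where m: "m > 0" "unit (y ^ m / c powi l)" "s = of_int l / of_nat m"
    using assms(2) by (auto simp: has_order_def)
  have "unit ((x ^ n / c powi k) ^ m * (y ^ m / c powi l) ^ n)"
    by (intro unit_mult unit_power n m)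
  also have "(x ^ n / c powi k) ^ m * (y ^ m / c powi l) ^ n = (x * y) ^ (n * m) / c powi (k * int m + l * int n)"
    using c_nz
    by (simp add: power_divide power_int_add power_int_mult power_mult_distrib flip: power_mult)
       (simp add: mult.commute)
  finally show ?thesis
    unfolding has_order_def using n m
    by (intro exI[of _ "n * m"] exI[of _ "k * int m + l * int n"]) (simp add: field_simps)
qed

text \<open>If \<open>x ^ n\<close> lies in \<open>A\<close> but \<open>x\<close> does not, then 1/x
  does, and \<open>x ^ n\<close> times a power of 1/x recovers \<open>x\<close>. Conversely, a
  negative order of some x in \<open>A\<close> would make a positive power of \<open>c\<close>
  invertible.\<close>

lemma has_order_nonneg_iff:
  assumes "has_order x r"
  shows "r \<ge> 0 \<longleftrightarrow> x \<in> A"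
proof -
  obtain n k where n: "n > 0" "unit (x ^ n / c powi k)" and r: "r = of_int k / of_nat n"
    using assms by (auto simp: has_order_def)
  define u where "u = x ^ n / c powi k"
  have u: "u \<in> A" "inverse u \<in> A" "u \<noteq> 0" and "x \<noteq> 0"
    using n by (auto simp: unit_def u_def)
  have xn: "x ^ n = u * c powi k" using c_nz by (simp add: u_def)
  have "r \<ge> 0 \<longleftrightarrow> k \<ge> 0" using n(1) by (simp add: r zero_le_divide_iff)
  also have "\<dots> \<longleftrightarrow> x \<in> A"
  proof
    assume "k \<ge> 0"
    then have xnA: "x ^ n \<in> A" unfolding xn
      by (simp add: power_int_def is_subringD[OF sub] is_subring_power[OF sub] u c_in)
    show "x \<in> A"
    proof (rule ccontr)
      assume "x \<notin> A"
      then have "inverse x \<in> A" using valuation_ring by blast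
      then have "x ^ n * inverse x ^ (n - 1) \<in> A"
        by (intro is_subringD(6)[OF sub] is_subring_power[OF sub] xnA)
      also have "x ^ n * inverse x ^ (n - 1) = x"
        using n(1) \<open>x \<noteq> 0\<close> by (cases n) (simp_all add: field_simps)
      finally show False using \<open>x \<notin> A\<close> by blast
    qed
  next
    assume "x \<in> A"
    show "k \<ge> 0"
    proof (rule ccontr)
      assume k: "\<not> k \<ge> 0"
      then have "c ^ nat (- k) * (x ^ n * inverse u) = 1"
        using c_nz u(3) by (simp add: xn power_int_def field_simps)
      moreover have "x ^ n * inverse u \<in> A"
        by (intro is_subringD(6)[OF sub] is_subring_power[OF sub] u \<open>x \<in> A\<close>)
      ultimately show False using not_unit_c[of "nat (- k)"] k by auto
    qed
  qed
  finally show ?thesis .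
qed

lemma has_order_inverse: "has_order x r \<Longrightarrow> has_order (inverse x) (- r)"
proof -
  assume "has_order x r"
  then obtain n k where n: "n > 0" "unit (x ^ n / c powi k)" and r: "r = of_int k / of_nat n"
    by (auto simp: has_order_def)
  from unit_inverse[OF n(2)] have "unit (inverse x ^ n / c powi (- k))"
    using c_nz by (simp add: power_inverse power_int_minus divide_inverse mult.commute)
  then show ?thesis unfolding has_order_def using n(1) r
    by (intro exI[of _ n] exI[of _ "- k"]) simp
qed

end

section \<open>The p-adic valuation on an algebraic field\<close>

locale prime_avoiding_subring = subring_avoiding_inverse A "of_nat p" for A :: "'a::field_char_0 set" and p +
  assumes prime: "prime p" and alg: "algebraic (x :: 'a)"
begin

text \<open>By Bezout, a multiple of \<open>a\<close> has the form 1 - p t, and such elements are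
  invertible by \<open>one_minus_unit\<close>.\<close>

lemma unit_of_int:
  assumes "\<not> int p dvd a"
  shows "unit (of_int a)"
proof -
  have "coprime a (int p)"
    using prime assms prime_imp_coprime[of "int p" a] by (simp add: coprime_commute)
  then obtain s t where "s * a + t * int p = 1"
    using bezout_int[of a "int p"] by (metis coprime_iff_gcd_eq_1)
  then have "of_int s * of_int a + of_int t * of_nat p = (1::'a)"
    by (metis of_int_1 of_int_add of_int_mult of_int_of_nat_eq)
  then have e: "of_int s * of_int a = 1 - of_nat p * (of_int t :: 'a)"
    by (simp add: algebra_simps)
  have "of_int t \<in> A" by (rule is_subring_of_int[OF sub])
  note * = one_minus_unit[OF this]
  have nz: "of_int a \<noteq> (0::'a)" using e * by auto
  have "inverse (of_int a) = of_int s * inverse (1 - of_nat p * (of_int t :: 'a))"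
    using e *(1) nz by (simp add: field_simps)
  also have "\<dots> \<in> A" by (intro is_subringD(6)[OF sub] is_subring_of_int[OF sub] *)
  finally show ?thesis using nz by (simp add: unit_def is_subring_of_int[OF sub])
qed

lemma has_order_of_int:
  assumes "a \<noteq> 0"
  shows "has_order (of_int a) (of_nat (multiplicity (int p) a))"
proof -
  have "\<not> is_unit (int p)" using prime by auto
  then obtain y where y: "a = int p ^ multiplicity (int p) a * y" "\<not> int p dvd y"
    using multiplicity_decompose'[OF assms] by metis
  have "of_int a / of_nat p powi int (multiplicity (int p) a) = (of_int y :: 'a)"
    using c_nz by (subst y(1)) simp
  then show ?thesis
    unfolding has_order_def using unit_of_int[OF y(2)]
    by (intro exI[of _ 1] exI[of _ "int (multiplicity (int p) a)"]) simp
qed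

lemma has_order_if_power:
  assumes "has_order (x ^ n) r" "n > 0"
  shows "has_order x (r / n)"
proof -
  obtain m k where m: "m > 0" "unit ((x ^ n) ^ m / of_nat p powi k)" and r: "r = of_int k / of_nat m"
    using assms(1) by (auto simp: has_order_def)
  then show ?thesis unfolding has_order_def using assms(2)
    by (intro exI[of _ "n * m"] exI[of _ k]) (simp add: power_mult[symmetric] del: power_mult)
qed

lemma unit_has_order: "unit u \<Longrightarrow> has_order u 0"
  unfolding has_order_def by (intro exI[of _ 1] exI[of _ 0]) simp

text \<open>In an integral equation \<open>\<Sum> a\<^sub>i x\<^sup>i = 0\<close> two nonzero terms must have the same order.\<close>

lemma has_order_exists:
  assumes "x \<noteq> 0"
  obtains r where "has_order x r"
proof -
  obtain q where q: "poly (map_poly of_int q) x = 0" "q \<noteq> 0"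
    using algebraicE'[OF alg] by metis
  define t where "t i = of_int (coeff q i) * x ^ i" for i
  define I where "I = {i. i \<le> degree q \<and> coeff q i \<noteq> 0}"
  have "degree q \<in> I" using q(2) by (simp add: I_def)
  then have I: "finite I" "I \<noteq> {}" by (auto simp: I_def)
  have tnz: "t i \<noteq> 0" if "i \<in> I" for i
    using that assms by (simp add: I_def t_def)
  then obtain i where i: "i \<in> I" "\<forall>j\<in>I. t j / t i \<in> A"
    using finite_divides_all[OF I, of t] by blast
  have "(\<Sum>j\<in>I. t j) = (\<Sum>j\<le>degree q. t j)"
    by (rule sum.mono_neutral_left) (auto simp: I_def t_def)
  also have "\<dots> = 0" using q(1) by (simp add: poly_altdef t_def degree_map_poly coeff_map_poly)
  finally have "(\<Sum>j\<in>I. t j / t i) = 0" by (simp flip: sum_divide_distrib)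
  then have s: "(\<Sum>j\<in>I - {i}. t j / t i) = - 1"
    using I i(1) tnz[OF i(1)] by (simp add: sum.remove add_eq_0_iff)
  have "unit (- 1)" by (simp add: unit_def is_subringD[OF sub])
  \<comment> \<open>The remaining quotients lie in \<open>A\<close> and sum to the unit - 1;
    nonunits are closed under addition, so one quotient is a unit.\<close>
  then obtain j where j: "j \<in> I" "j \<noteq> i" "unit (t j / t i)"
    using nonunit_sum[of "I - {i}" "\<lambda>j. t j / t i"] s I(1) i(2) by fastforce
  define aj ai where "aj = (of_int (coeff q j) :: 'a)" and "ai = (of_int (coeff q i) :: 'a)"
  obtain rj ri where r: "has_order aj rj" "has_order ai ri" and nz: "aj \<noteq> 0" "ai \<noteq> 0"
    using has_order_of_int j(1) i(1) by (fastforce simp: I_def aj_def ai_def)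
  \<comment> \<open>A power of \<open>x\<close> with nonzero exponent i - j or j - i is thereby a
    unit times a quotient of integers, whose orders are known.\<close>
  have xx: "x ^ j / x ^ i = (t j / t i) * (ai * inverse aj)"
    using nz assms by (simp add: t_def aj_def ai_def field_simps)
  have o: "has_order (x ^ j / x ^ i) (0 + (ri + - rj))"
    unfolding xx by (intro has_order_mult has_order_inverse unit_has_order r j)
  show ?thesis
  proof (cases "i < j")
    case True
    then have "x ^ j / x ^ i = x ^ (j - i)" using assms by (simp add: power_diff)
    then show ?thesis using o True has_order_if_power that by (metis zero_less_diff)
  next
    case False
    then have "i - j > 0" using j(2) by simp
    moreover have "inverse (x ^ j / x ^ i) = x ^ (i - j)" using assms False by (simp add: power_diff)
    ultimately show ?thesis using has_order_inverse[OF o] has_order_if_power that by metis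
  qed
qed

definition ord_value :: "'a \<Rightarrow> real" where
  "ord_value x = (THE r. has_order x r)"

lemma ord_value_eq: "has_order x r \<Longrightarrow> ord_value x = r"
  unfolding ord_value_def using has_order_unique by blast

lemma has_order_ord_value: "x \<noteq> 0 \<Longrightarrow> has_order x (ord_value x)"
  using has_order_exists ord_value_eq by metis

lemma ord_value_mult: "x \<noteq> 0 \<Longrightarrow> y \<noteq> 0 \<Longrightarrow> ord_value (x * y) = ord_value x + ord_value y"
  by (intro ord_value_eq has_order_mult has_order_ord_value)

text \<open>One summand divides the other, say x / y lies in \<open>A\<close>; then so does (x + y)
  / y, which has nonnegative order.\<close>

lemma ord_value_add:
  assumes "x \<noteq> 0" "y \<noteq> 0" "x + y \<noteq> 0"
  shows "ord_value (x + y) \<ge> min (ord_value x) (ord_value y)"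
proof -
  have *: "ord_value (x + y) \<ge> ord_value y" if "x \<noteq> 0" "y \<noteq> 0" "x + y \<noteq> 0" "x / y \<in> A" for x y
  proof -
    have "(x + y) / y = x / y + 1" using that by (simp add: field_simps)
    then have "(x + y) / y \<in> A" using that(4) is_subringD[OF sub] by metis
    then have "ord_value ((x + y) / y) \<ge> 0"
      using has_order_nonneg_iff[OF has_order_ord_value, of "(x + y) / y"] that by simp
    moreover have "ord_value ((x + y) / y * y) = ord_value ((x + y) / y) + ord_value y"
      using that by (intro ord_value_mult) auto
    ultimately show ?thesis using that by simp
  qed
  have "x / y \<in> A \<or> y / x \<in> A" using valuation_ring[of "x / y"] by auto
  then show ?thesis using *[of x y] *[of y x] assms by (auto simp: add.commute min_def)
qed

text \<open>Real exponents, since orders need not be integers. The value at 0 is separate, because 0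
  has no order.\<close>

definition abs_value :: "'a \<Rightarrow> real" where
  "abs_value x = (if x = 0 then 0 else real p powr (- ord_value x))"

lemma is_absolute_value_abs_value: "is_absolute_value abs_value"
proof -
  have p: "real p > 1" using prime_gt_1_nat[OF prime] by simp
  have nn: "abs_value x \<ge> 0" for x by (simp add: abs_value_def)
  have "abs_value (x + y) \<le> abs_value x + abs_value y" for x y
  proof (cases "x = 0 \<or> y = 0 \<or> x + y = 0")
    case False
    then have "min (ord_value x) (ord_value y) \<le> ord_value (x + y)"
      by (intro ord_value_add) auto
    then have "ord_value x \<le> ord_value (x + y) \<or> ord_value y \<le> ord_value (x + y)" by linarith
    then have "abs_value (x + y) \<le> abs_value x \<or> abs_value (x + y) \<le> abs_value y"
      using False p by (auto simp: abs_value_def)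
    then show ?thesis using nn[of x] nn[of y] by linarith
  qed (use nn in \<open>auto simp: abs_value_def\<close>)
  moreover have "abs_value (x * y) = abs_value x * abs_value y" for x y
    by (simp add: abs_value_def ord_value_mult powr_add[symmetric])
  moreover have "abs_value x = 0 \<longleftrightarrow> x = 0" for x using p by (simp add: abs_value_def)
  ultimately show ?thesis using nn by (simp add: is_absolute_value_def)
qed

lemma abs_value_of_rat: "abs_value (of_rat q) = padic_abs p q"
proof (cases "q = 0")
  case False
  obtain a b where ab: "quotient_of q = (a, b)" by (cases "quotient_of q")
  then have q: "q = of_int a / of_int b" and b: "b \<noteq> 0"
    using quotient_of_div quotient_of_denom_pos by (auto, fastforce)
  have a: "a \<noteq> 0" using False q by auto
  define k where "k = int (multiplicity (int p) a) - int (multiplicity (int p) b)"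
  have "has_order (of_int a * inverse (of_int b)) (of_nat (multiplicity (int p) a) + - of_nat (multiplicity (int p) b))"
    by (intro has_order_mult has_order_inverse has_order_of_int a b)
  then have "ord_value (of_rat q) = of_int k"
    by (intro ord_value_eq) (simp add: q of_rat_mult of_rat_inverse divide_inverse k_def)
  then have "abs_value (of_rat q) = real p powr of_int (- k)"
    using False by (simp add: abs_value_def)
  also have "\<dots> = real p powi (- k)"
    using prime_gt_0_nat[OF prime] by (intro powr_real_of_int') auto
  also have "\<dots> = padic_abs p q"
    using False ab by (simp add: padic_abs_def k_def)
  finally show ?thesis .
qed (simp add: abs_value_def padic_abs_def)

end

section \<open>Existence of extensions for every rational place\<close>

lemma subring_avoiding_inverse_exists:
  fixes p :: nat
  assumes "prime p"
  shows "\<exists>A :: 'a::field_char_0 set. subring_avoiding_inverse A (of_nat p)"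
proof -
  define S where "S = {A :: 'a set. is_subring A \<and> inverse (of_nat p) \<notin> A}"
  have "\<exists>M\<in>S. \<forall>B\<in>S. M \<subseteq> B \<longrightarrow> B = M"
  proof (rule subset_Zorn_nonempty)
    \<comment> \<open>The integers do not contain 1/p, so they make the family for Zorn's lemma
      nonempty.\<close>
    have "is_subring (\<int> :: 'a set)" by (simp add: is_subring_def)
    moreover have "inverse (of_nat p) \<notin> (\<int> :: 'a set)"
    proof
      assume "inverse (of_nat p) \<in> (\<int> :: 'a set)"
      then obtain k where "inverse (of_nat p) = (of_int k :: 'a)" by (auto elim: Ints_cases)
      then have "of_int (int p * k) = (of_int 1 :: 'a)"
        using prime_gt_0_nat[OF assms] by (simp add: field_simps)
      then have "int p * k = 1" by (simp only: of_int_eq_iff)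
      then show False using assms by (metis dvd_triv_left not_prime_unit prime_nat_int_transfer)
    qed
    ultimately show "S \<noteq> {}" by (auto simp: S_def)
    fix C assume C: "C \<noteq> {}" "subset.chain S C"
    have "is_subring (\<Union>C)"
    proof (rule is_subring_chain_Union[OF C(1)])
      show "\<And>A. A \<in> C \<Longrightarrow> is_subring A"
        using C(2) by (auto simp: subset.chain_def S_def)
      show "\<And>A B. A \<in> C \<Longrightarrow> B \<in> C \<Longrightarrow> A \<subseteq> B \<or> B \<subseteq> A"
        using C(2) by (auto simp: subset_chain_def)
    qed
    moreover have "inverse (of_nat p) \<notin> B" if "B \<in> C" for B
      using C(2) that by (auto simp: subset_chain_def S_def)
    ultimately show "\<Union>C \<in> S" by (simp add: S_def)
  qed
  then obtain M where M: "M \<in> S" "\<forall>B\<in>S. M \<subseteq> B \<longrightarrow> B = M" by blast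
  have "subring_avoiding_inverse M (of_nat p)"
  proof
    show "is_subring M" "inverse (of_nat p) \<notin> M" using M(1) by (auto simp: S_def)
    then show "of_nat p \<in> M" using is_subring_of_int[of M "int p"] by simp
    show "of_nat p \<noteq> (0::'a)" using prime_gt_0_nat[OF assms] by simp
    show "B = M" if "is_subring B" "M \<subseteq> B" "inverse (of_nat p) \<notin> B" for B
      using M(2) that by (auto simp: S_def)
  qed
  then show ?thesis by blast
qed

lemma padic_abs_extends:
  assumes "prime p"
  shows "\<exists>w :: qbar \<Rightarrow> real. is_absolute_value w \<and> (\<forall>q. w (of_rat q) = padic_abs p q)"
proof -
  obtain A :: "qbar set" where "subring_avoiding_inverse A (of_nat p)"
    using subring_avoiding_inverse_exists[OF assms] by blast
  then interpret prime_avoiding_subring A p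
    unfolding prime_avoiding_subring_def prime_avoiding_subring_axioms_def
    using assms algebraic_qbar by blast
  show ?thesis
    using is_absolute_value_abs_value abs_value_of_rat by blast
qed

text \<open>The complex modulus is pulled back along an embedding.\<close>

lemma rational_abs_extends:
  "\<exists>w :: qbar \<Rightarrow> real. is_absolute_value w \<and> (\<forall>q. w (of_rat q) = \<bar>real_of_rat q\<bar>)"
proof -
  obtain f :: "qbar \<Rightarrow> complex" where f: "is_ring_hom f" by (rule qbar_embedding)
  have "norm (of_rat q :: complex) = \<bar>real_of_rat q\<bar>" for q
    by (cases q) (simp add: of_rat_rat norm_divide)
  moreover have "is_absolute_value (\<lambda>x. norm (f x))"
    by (simp add: is_absolute_value_def is_ring_homD[OF f] is_ring_hom_eq_0_iff[OF f]
        norm_mult norm_triangle_ineq)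
  ultimately show ?thesis using is_ring_hom_of_rat[OF f] by metis
qed

text \<open>Existence of an extension gives the choice operator its meaning. From here on the choice
  enters only through these two properties.\<close>

lemma place_ext:
  assumes "v \<in> places_Q"
  shows "is_absolute_value (place_ext v)" "place_ext v (of_rat q) = v q"
proof -
  have "\<exists>w :: qbar \<Rightarrow> real. is_absolute_value w \<and> (\<forall>q. w (to_ac q) = v q)"
    using assms rational_abs_extends padic_abs_extends by (auto simp: places_Q_def to_ac_eq_of_rat)
  from someI_ex[OF this]
  show "is_absolute_value (place_ext v)" "place_ext v (of_rat q) = v q"
    unfolding place_ext_def by (auto simp: to_ac_eq_of_rat)
qed

subsection \<open>The product formula\<close>

text \<open>The logarithm of the prime factorisation. \<open>P\<close> may be larger than the set of
  prime divisors, so that one set serves both numerator and denominator.\<close>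

lemma sum_multiplicity_ln:
  fixes a :: int
  assumes a: "a \<noteq> 0" and P: "finite P" "\<And>p. p \<in> P \<Longrightarrow> prime p"
    "\<And>p. prime p \<Longrightarrow> int p dvd a \<Longrightarrow> p \<in> P"
  shows "(\<Sum>p\<in>P. real (multiplicity (int p) a) * ln (real p)) = ln \<bar>real_of_int a\<bar>"
proof -
  define Q where "Q = {p. prime p \<and> int p dvd a}"
  have Q: "prime_factors a = int ` Q"
  proof (intro equalityI subsetI)
    fix q assume "q \<in> prime_factors a"
    then have q: "prime q" "q dvd a" by auto
    then have "q = int (nat q)" using prime_ge_0_int[of q] by simp
    with q show "q \<in> int ` Q" by (auto simp: Q_def intro!: image_eqI[of _ _ "nat q"] simp flip: prime_nat_int_transfer)
  qed (use a in \<open>auto simp: Q_def prime_factors_dvd\<close>)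
  have "Q \<subseteq> P" using P(3) by (auto simp: Q_def)
  then have fQ: "finite Q" using P(1) by (rule finite_subset)
  have "\<bar>a\<bar> = (\<Prod>p\<in>Q. int p ^ multiplicity (int p) a)"
    using prod_prime_factors[OF a] unfolding Q by (simp add: prod.reindex)
  then have "real_of_int \<bar>a\<bar> = real_of_int (\<Prod>p\<in>Q. int p ^ multiplicity (int p) a)"
    by (rule arg_cong)
  then have "\<bar>real_of_int a\<bar> = (\<Prod>p\<in>Q. real p ^ multiplicity (int p) a)"
    by simp
  then have "ln \<bar>real_of_int a\<bar> = ln (\<Prod>p\<in>Q. real p ^ multiplicity (int p) a)"
    by (rule arg_cong)
  also have "\<dots> = (\<Sum>p\<in>Q. ln (real p ^ multiplicity (int p) a))"
    by (rule ln_prod) (use fQ in \<open>auto simp: Q_def prime_gt_0_nat\<close>)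
  also have "\<dots> = (\<Sum>p\<in>Q. real (multiplicity (int p) a) * ln (real p))"
    by (intro sum.cong refl ln_realpow)
  also have "\<dots> = (\<Sum>p\<in>P. real (multiplicity (int p) a) * ln (real p))"
    by (rule sum.mono_neutral_left)
      (use P \<open>Q \<subseteq> P\<close> in \<open>auto simp: Q_def not_dvd_imp_multiplicity_0\<close>)
  finally show ?thesis ..
qed

lemma padic_abs_le_1:
  assumes "prime p" "\<not> int p dvd snd (quotient_of q)"
  shows "padic_abs p q \<le> 1"
proof -
  obtain a b where ab: "quotient_of q = (a, b)" by (cases "quotient_of q")
  with assms have "multiplicity (int p) b = 0" by (simp add: not_dvd_imp_multiplicity_0)
  moreover have "real p powi (- int k) \<le> 1" for k
    using prime_gt_0_nat[OF assms(1)] by (simp add: power_int_minus inverse_le_1_iff)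
  ultimately show ?thesis using ab by (simp add: padic_abs_def)
qed

lemma padic_abs_of_nat_le_1: "prime p \<Longrightarrow> padic_abs p (of_nat n) \<le> 1"
  by (rule padic_abs_le_1) (use not_prime_unit[of "int p"] in auto)

lemma padic_abs_prime:
  assumes "prime p" "prime q"
  shows "padic_abs p (of_nat q) = (if p = q then 1 / real p else 1)"
proof -
  have "multiplicity (int p) (int q) = (if p = q then 1 else 0)"
    using assms by (auto simp: prime_multiplicity_other)
  then show ?thesis using assms by (auto simp: padic_abs_def power_int_minus divide_inverse)
qed

text \<open>Places are functions rather than primes, so reindexing a sum by primes needs this. The
  q-adic value of q is below 1, whereas its p-adic value is 1 for every other p.\<close>

lemma inj_on_padic_abs: "inj_on padic_abs {p. prime p}"
proof (rule inj_onI)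
  fix p q assume pq: "p \<in> {p. prime p}" "q \<in> {p. prime p}" and eq: "padic_abs p = padic_abs q"
  then have "padic_abs p (of_nat q) = padic_abs q (of_nat q)" by simp
  then show "p = q" using pq padic_abs_prime[of p q] padic_abs_prime[of q q] prime_gt_1_nat[of q]
    by (auto split: if_splits)
qed

lemma rational_abs_neq_padic_abs: "prime p \<Longrightarrow> (\<lambda>q. \<bar>real_of_rat q\<bar>) \<noteq> padic_abs p"
  using padic_abs_of_nat_le_1[of p 2] by (auto dest: fun_cong[of _ _ 2])

lemma summable_on_finite_nonzero:
  fixes f :: "'a \<Rightarrow> real"
  assumes "finite {x \<in> A. f x \<noteq> 0}"
  shows "f summable_on A"
  using summable_on_finite[OF assms, of f]
  by (subst (asm) summable_on_cong_neutral[of A _ f f]) auto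

text \<open>Only the archimedean place and the primes dividing numerator or denominator contribute,
  and by unique factorisation the p-adic terms add up to the negative of the archimedean
  one.\<close>

theorem product_formula_Q:
  assumes q: "q \<noteq> 0"
  shows "(\<lambda>v. ln (v q)) summable_on places_Q" "(\<Sum>\<^sub>\<infinity>v\<in>places_Q. ln (v q)) = 0"
proof -
  obtain a b where ab: "quotient_of q = (a, b)" by (cases "quotient_of q")
  then have qd: "q = of_int a / of_int b" and b: "b \<noteq> 0"
    using quotient_of_div quotient_of_denom_pos by (auto, fastforce)
  have a: "a \<noteq> 0" using q qd by auto
  define P where "P = {p. prime p \<and> int p dvd a * b}"
  have "P \<subseteq> nat ` prime_factors (a * b)"
    using a b by (auto simp: P_def prime_factors_dvd intro!: image_eqI[of _ _ "int _"])
  then have fP: "finite P" by (rule finite_subset) simp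
  define F where "F = insert (\<lambda>q. \<bar>real_of_rat q\<bar>) (padic_abs ` P)"
  have F: "finite F" "F \<subseteq> places_Q" using fP by (auto simp: F_def places_Q_def P_def)
  have val: "ln (padic_abs p q) = real (multiplicity (int p) b) * ln p - real (multiplicity (int p) a) * ln p"
    if "prime p" for p
  proof -
    have "padic_abs p q = real p powr of_int (int (multiplicity (int p) b) - int (multiplicity (int p) a))"
      unfolding padic_abs_def ab prod.case
      using q prime_gt_0_nat[OF that] by (subst powr_real_of_int') auto
    then show ?thesis by (simp add: ln_powr algebra_simps)
  qed
  have out: "ln (v q) = 0" if v: "v \<in> places_Q - F" for v
  proof -
    obtain p where p: "prime p" "v = padic_abs p" "p \<notin> P"
      using v by (auto simp: places_Q_def F_def)
    then have "\<not> int p dvd a" "\<not> int p dvd b" by (auto simp: P_def)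
    then have "multiplicity (int p) a = 0" "multiplicity (int p) b = 0"
      by (simp_all add: not_dvd_imp_multiplicity_0)
    then show ?thesis using val[OF p(1)] p(2) by simp
  qed
  have "{v \<in> places_Q. ln (v q) \<noteq> 0} \<subseteq> F" using out by blast
  then show "(\<lambda>v. ln (v q)) summable_on places_Q"
    using F(1) by (intro summable_on_finite_nonzero) (rule finite_subset)
  have "(\<Sum>\<^sub>\<infinity>v\<in>places_Q. ln (v q)) = (\<Sum>v\<in>F. ln (v q))"
    unfolding infsum_finite[OF F(1), symmetric]
    by (rule infsum_cong_neutral) (use out F(2) in auto)
  also have "\<dots> = ln \<bar>real_of_rat q\<bar> + (\<Sum>v\<in>padic_abs ` P. ln (v q))"
    unfolding F_def using fP rational_abs_neq_padic_abs
    by (subst sum.insert) (auto simp: P_def)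
  also have "(\<Sum>v\<in>padic_abs ` P. ln (v q)) = (\<Sum>p\<in>P. ln (padic_abs p q))"
    by (subst sum.reindex) (auto simp: P_def intro: inj_on_subset[OF inj_on_padic_abs])
  also have "\<dots> = (\<Sum>p\<in>P. real (multiplicity (int p) b) * ln p) - (\<Sum>p\<in>P. real (multiplicity (int p) a) * ln p)"
    unfolding sum_subtractf[symmetric] by (intro sum.cong refl val) (simp add: P_def)
  also have "\<dots> = ln \<bar>real_of_int b\<bar> - ln \<bar>real_of_int a\<bar>"
    using a b fP by (subst (1 2) sum_multiplicity_ln) (auto simp: P_def)
  also have "ln \<bar>real_of_rat q\<bar> = ln \<bar>real_of_int a\<bar> - ln \<bar>real_of_int b\<bar>"
    using a b by (simp add: qd of_rat_divide abs_divide ln_div)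
  finally show "(\<Sum>\<^sub>\<infinity>v\<in>places_Q. ln (v q)) = 0" by simp
qed

subsection \<open>Absolute values\<close>

lemma is_absolute_valueD:
  assumes "is_absolute_value w"
  shows "w x \<ge> 0" "w x = 0 \<longleftrightarrow> x = 0" "w (x * y) = w x * w y" "w (x + y) \<le> w x + w y"
    "w 0 = 0" "w 1 = 1" "w (- x) = w x" "w (x ^ n) = w x ^ n" "w (inverse x) = inverse (w x)"
proof -
  have nn: "w x \<ge> 0" and z: "w x = 0 \<longleftrightarrow> x = 0" and m: "w (x * y) = w x * w y" for x y
    using assms by (simp_all add: is_absolute_value_def)
  show "w x \<ge> 0" "w x = 0 \<longleftrightarrow> x = 0" "w (x * y) = w x * w y" by fact+
  show "w (x + y) \<le> w x + w y" using assms by (simp add: is_absolute_value_def)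
  show w0: "w 0 = 0" by (simp add: z)
  show o: "w 1 = 1" using m[of 1 1] z[of 1] by simp
  have "w (- 1) * w (- 1) = 1" using m[of "- 1" "- 1"] o by simp
  then have "w (- 1) = 1" using nn[of "- 1"] by (metis abs_of_nonneg abs_square_eq_1 power2_eq_square)
  then show "w (- x) = w x" using m[of "- 1" x] by simp
  show "w (x ^ n) = w x ^ n" by (induction n) (simp_all add: o m)
  show "w (inverse x) = inverse (w x)"
  proof (cases "x = 0")
    case False
    then have "w x * w (inverse x) = 1" using m[of x "inverse x"] o by simp
    then show ?thesis by (metis inverse_unique)
  qed (simp add: w0)
qed

lemma absolute_value_sum_le:
  assumes "is_absolute_value w"
  shows "w (sum f I) \<le> (\<Sum>i\<in>I. w (f i))"
proof (induction I rule: infinite_finite_induct)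
  case (insert i I)
  then show ?case using is_absolute_valueD(4)[OF assms, of "f i" "sum f I"] by simp
qed (simp_all add: is_absolute_valueD[OF assms])

lemma absolute_value_prod:
  assumes "is_absolute_value w"
  shows "w (prod f I) = (\<Prod>i\<in>I. w (f i))"
  by (induction I rule: infinite_finite_induct) (simp_all add: is_absolute_valueD[OF assms])

text \<open>Expand \<open>(x + y)\<^sup>N\<close>, bound the binomial coefficients by 1, and let \<open>N\<close> tend to infinity.\<close>

lemma ultrametric:
  assumes w: "is_absolute_value w" and nat: "\<And>n. w (of_nat n) \<le> 1"
  shows "w (x + y) \<le> max (w x) (w y)"
proof (rule ccontr)
  define M where "M = max (w x) (w y)"
  assume "\<not> ?thesis"
  then have less: "M < w (x + y)" unfolding M_def by linarith
  have M: "M \<ge> 0" "w x \<le> M" "w y \<le> M" using is_absolute_valueD(1)[OF w] by (auto simp: M_def max_def)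
  define q where "q = M / w (x + y)"
  have q: "0 \<le> q" "q < 1" using less M(1) by (simp_all add: q_def)
  have "1 \<le> of_nat N * q ^ N + q ^ N" for N
  proof -
    have "w (x + y) ^ N = w (\<Sum>k\<le>N. of_nat (N choose k) * x ^ k * y ^ (N - k))"
      by (simp add: binomial_ring is_absolute_valueD(8)[OF w, symmetric])
    also have "\<dots> \<le> (\<Sum>k\<le>N. w (of_nat (N choose k) * x ^ k * y ^ (N - k)))"
      by (rule absolute_value_sum_le[OF w])
    also have "\<dots> \<le> (\<Sum>k\<le>N. M ^ N)"
    proof (rule sum_mono)
      fix k assume "k \<in> {..N}"
      then have "M ^ N = 1 * M ^ k * M ^ (N - k)" by (simp flip: power_add)
      then show "w (of_nat (N choose k) * x ^ k * y ^ (N - k)) \<le> M ^ N"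
        using M is_absolute_valueD(1)[OF w] nat
        by (simp only: is_absolute_valueD(3,8)[OF w]) (intro mult_mono power_mono; simp)
    qed
    also have "\<dots> = (of_nat N + 1) * M ^ N" by simp
    finally have "w (x + y) ^ N \<le> (of_nat N + 1) * M ^ N" .
    then have "1 \<le> (of_nat N + 1) * M ^ N / w (x + y) ^ N"
      using less M(1) by simp
    then show ?thesis by (simp add: q_def power_divide algebra_simps add_divide_distrib)
  qed
  moreover have "(\<lambda>N. of_nat N * q ^ N + q ^ N) \<longlonglongrightarrow> 0 + 0"
    using q by (intro tendsto_add powser_times_n_limit_0 LIMSEQ_power_zero) auto
  ultimately have "1 \<le> (0::real) + 0"
    by (intro LIMSEQ_le_const[of "\<lambda>N. of_nat N * q ^ N + q ^ N" "0 + 0" 1]) auto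
  then show False by simp
qed

lemma ultrametric_sum_le:
  assumes w: "is_absolute_value w" and nat: "\<And>n. w (of_nat n) \<le> 1"
    and B: "B \<ge> 0" "\<And>i. i \<in> I \<Longrightarrow> w (f i) \<le> B"
  shows "w (sum f I) \<le> B"
  using B(2)
proof (induction I rule: infinite_finite_induct)
  case (insert i I)
  then show ?case using ultrametric[OF w nat, of "f i" "sum f I"] by fastforce
qed (use B(1) in \<open>simp_all add: is_absolute_valueD[OF w]\<close>)

text \<open>If \<open>w x\<close> exceeded 1, the leading term of the equation would be strictly
  larger than all others, which the ultrametric inequality forbids.\<close>

lemma integral_root_abs_le_1:
  assumes w: "is_absolute_value w" and nat: "\<And>n. w (of_nat n) \<le> 1"
    and p: "lead_coeff p = 1" "\<And>i. w (coeff p i) \<le> 1" "poly p x = 0"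
  shows "w x \<le> 1"
proof (rule ccontr)
  assume "\<not> ?thesis"
  then have gt: "w x > 1" by simp
  obtain d where d: "degree p = Suc d"
  proof (cases "degree p")
    case 0
    then have "poly p x = 1" using p(1) by (simp add: poly_altdef)
    with p(3) show ?thesis by simp
  qed (use that in blast)
  have "x ^ Suc d = - (\<Sum>i\<le>d. coeff p i * x ^ i)"
    using p(1,3) d by (simp add: poly_altdef eq_neg_iff_add_eq_0 add.commute)
  then have "w x ^ Suc d = w (\<Sum>i\<le>d. coeff p i * x ^ i)"
    by (metis is_absolute_valueD(7,8)[OF w])
  also have "\<dots> \<le> w x ^ d"
  proof (rule ultrametric_sum_le[OF w nat])
    fix i assume "i \<in> {..d}"
    then have "1 * w x ^ i \<le> w x ^ d" using gt by (simp add: power_increasing)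
    moreover have "w (coeff p i) * w x ^ i \<le> 1 * w x ^ i"
      using p(2) gt by (intro mult_right_mono) auto
    ultimately show "w (coeff p i * x ^ i) \<le> w x ^ d"
      by (simp add: is_absolute_valueD[OF w])
  qed (use gt in simp)
  finally show False using gt power_strict_increasing[of d "Suc d" "w x"] by simp
qed

subsection \<open>Properties of the height\<close>

lemma is_subring_Rats: "is_subring (\<rat> :: 'a::field_char_0 set)"
  by (simp add: is_subring_def)

lemma range_to_ac: "range to_ac = (\<rat> :: qbar set)"
  by (auto simp: to_ac_eq_of_rat Rats_def)

lemma conjugates_eq_orbit: "conjugates \<alpha> = orbit \<rat> \<alpha>"
  by (simp add: conjugates_def orbit_def range_to_ac)

lemma finite_conjugates [simp]: "finite (conjugates \<alpha>)"
  by (simp add: conjugates_eq_orbit finite_orbit)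

lemma conjugates_nonzero: "\<alpha> \<noteq> 0 \<Longrightarrow> \<beta> \<in> conjugates \<alpha> \<Longrightarrow> \<beta> \<noteq> 0"
  by (auto simp: conjugates_eq_orbit orbit_def Aut_over_iff is_ring_hom_eq_0_iff)

lemma conjugates_Aut_over:
  assumes "\<sigma> \<in> Aut_over K"
  shows "conjugates (\<sigma> \<alpha>) = conjugates \<alpha>"
proof -
  have \<sigma>: "\<sigma> \<in> Aut_over \<rat>"
    using assms by (auto simp: Aut_over_iff Rats_def is_ring_hom_of_rat)
  have sub: "orbit \<rat> (\<tau> \<beta>) \<subseteq> orbit \<rat> \<beta>" if "\<tau> \<in> Aut_over \<rat>" for \<tau> \<beta>
    unfolding orbit_def using Aut_over_comp[OF _ that] by (auto intro!: image_eqI[of _ _ "_ \<circ> \<tau>"])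
  have "inv_into UNIV \<sigma> (\<sigma> \<alpha>) = \<alpha>"
    using assms by (simp add: Aut_over_iff bij_is_inj)
  then show ?thesis
    using sub[OF \<sigma>, of \<alpha>] sub[OF Aut_over_inv[OF \<sigma>], of "\<sigma> \<alpha>"] by (simp add: conjugates_eq_orbit)
qed

lemma weil_height_Aut_over: "\<sigma> \<in> Aut_over K \<Longrightarrow> weil_height (\<sigma> \<alpha>) = weil_height \<alpha>"
  by (simp add: weil_height_def conjugates_Aut_over)

text \<open>The summand of the Weil height at one place, with the averaging factor moved inside, so
  that products and powers can be compared place by place.\<close>

definition local_height :: "(rat \<Rightarrow> real) \<Rightarrow> qbar \<Rightarrow> real" where
  "local_height v \<alpha> = (\<Sum>\<beta>\<in>conjugates \<alpha>. ln (max 1 (place_ext v \<beta>))) / real (card (conjugates \<alpha>))"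

lemma weil_height_eq_infsum: "weil_height \<alpha> = (\<Sum>\<^sub>\<infinity>v\<in>places_Q. local_height v \<alpha>)"
  unfolding weil_height_def local_height_def infsum_cmult_right'[symmetric] by simp

lemma local_height_nonneg: "local_height v \<alpha> \<ge> 0"
  unfolding local_height_def by (intro divide_nonneg_nonneg sum_nonneg) auto

lemma weil_height_nonneg: "weil_height \<alpha> \<ge> 0"
  unfolding weil_height_eq_infsum by (intro infsum_nonneg local_height_nonneg)

text \<open>At a finite place whose prime divides no denominator of a monic rational equation, all
  conjugates are integral and contribute nothing. Without summability \<open>infsum\<close> defaults
  to 0, and sums could not be split.\<close>

lemma local_height_summable: "(\<lambda>v. local_height v \<alpha>) summable_on places_Q"
proof -
  obtain P :: "rat poly" where P: "lead_coeff P = 1"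
    "\<And>f :: qbar \<Rightarrow> qbar. is_ring_hom f \<Longrightarrow> poly (map_poly of_rat P) (f \<alpha>) = 0"
    using conjugate_rational_root by blast
  define D where "D = (\<Prod>i\<le>degree P. snd (quotient_of (coeff P i)))"
  have D: "D \<noteq> 0" unfolding D_def using quotient_of_denom_pos' by (simp add: less_imp_neq[symmetric])
  define F where "F = insert (\<lambda>q. \<bar>real_of_rat q\<bar>) (padic_abs ` nat ` prime_factors D)"
  have "local_height v \<alpha> = 0" if v: "v \<in> places_Q - F" for v
  proof -
    obtain p where p: "prime p" "v = padic_abs p" "v \<notin> F"
      using v by (auto simp: places_Q_def F_def)
    have pD: "\<not> int p dvd D"
    proof
      assume "int p dvd D"
      then have "int p \<in> prime_factors D" using p(1) D by (simp add: prime_factors_dvd)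
      then have "p \<in> nat ` prime_factors D" by (rule image_eqI[rotated]) simp
      then show False using p by (simp add: F_def)
    qed
    note w = place_ext[of v]
    have vp: "v \<in> places_Q" using v by simp
    have "place_ext v \<beta> \<le> 1" if \<beta>: "\<beta> \<in> conjugates \<alpha>" for \<beta>
    proof (rule integral_root_abs_le_1[OF w(1)[OF vp]])
      show "place_ext v (of_nat n) \<le> 1" for n
        using w(2)[OF vp, of "of_nat n"] padic_abs_of_nat_le_1[OF p(1), of n] p(2) by simp
      show "lead_coeff (map_poly of_rat P :: qbar poly) = 1"
        using P(1) by (simp add: degree_map_poly coeff_map_poly)
      show "poly (map_poly of_rat P) \<beta> = 0"
        using \<beta> P(2) by (auto simp: conjugates_eq_orbit orbit_def Aut_over_iff)
      show "place_ext v (coeff (map_poly of_rat P) i) \<le> 1" for i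
      proof (cases "i \<le> degree P")
        case True
        then have "snd (quotient_of (coeff P i)) dvd D" unfolding D_def by (intro dvd_prodI) auto
        then have "\<not> int p dvd snd (quotient_of (coeff P i))" using pD dvd_trans by blast
        then show ?thesis
          using padic_abs_le_1[OF p(1)] w(2)[OF vp] p(2) by (simp add: coeff_map_poly)
      next
        case False
        then show ?thesis
          by (simp add: coeff_map_poly coeff_eq_0 is_absolute_valueD(5)[OF w(1)[OF vp]])
      qed
    qed
    then show ?thesis by (simp add: local_height_def max_absorb1)
  qed
  then have "{v \<in> places_Q. local_height v \<alpha> \<noteq> 0} \<subseteq> F" by blast
  moreover have "finite F" by (simp add: F_def)
  ultimately show ?thesis by (intro summable_on_finite_nonzero) (rule finite_subset)
qed

section \<open>Averages over joint conjugates\<close>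

lemma average_image:
  fixes f :: "'b \<Rightarrow> real"
  assumes S: "finite S" "S \<noteq> {}" and k: "\<And>y. y \<in> g ` S \<Longrightarrow> card {x \<in> S. g x = y} = k"
  shows "(\<Sum>x\<in>S. f (g x)) / real (card S) = (\<Sum>y\<in>g ` S. f y) / real (card (g ` S))"
proof -
  have *: "(\<Sum>x\<in>S. f (g x)) = real k * (\<Sum>y\<in>g ` S. f y)" for f :: "'b \<Rightarrow> real"
  proof -
    have "(\<Sum>x\<in>S. f (g x)) = (\<Sum>y\<in>g ` S. \<Sum>x\<in>{x \<in> S. g x = y}. f (g x))"
      by (rule sum.image_gen[OF S(1)])
    also have "\<dots> = (\<Sum>y\<in>g ` S. real k * f y)"
      by (intro sum.cong refl) (simp add: k)
    finally show ?thesis by (simp add: sum_distrib_left)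
  qed
  \<comment> \<open>The constant function 1 turns the fibre count into a relation between the two
    cardinalities.\<close>
  have c: "real (card S) = real k * real (card (g ` S))" using *[of "\<lambda>_. 1"] by simp
  moreover have "card S > 0" using S by (simp add: card_gt_0_iff)
  then have "k > 0" using c by (intro gr0I) simp
  ultimately show ?thesis using * by (simp add: field_simps)
qed

text \<open>The joint orbit stands for the embeddings of the field generated by \<alpha> and
  \<beta>. It is a common index set over which the heights of \<alpha>, \<beta> and expressions in
  both can be averaged.\<close>

definition conjugate_pairs :: "qbar \<Rightarrow> qbar \<Rightarrow> (qbar \<times> qbar) set" where
  "conjugate_pairs \<alpha> \<beta> = (\<lambda>\<sigma>. (\<sigma> \<alpha>, \<sigma> \<beta>)) ` Aut_over \<rat>"

text \<open>The automorphism group acts transitively on the set of conjugate pairs, so the fibres of an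
  equivariant map onto the conjugates of \<open>g \<alpha> \<beta>\<close> have the same cardinality.\<close>

lemma average_conjugate_pairs:
  fixes f :: "qbar \<Rightarrow> real"
  assumes g: "\<And>\<sigma> a b. \<sigma> \<in> Aut_over \<rat> \<Longrightarrow> g (\<sigma> a) (\<sigma> b) = \<sigma> (g a b)"
  shows "(\<Sum>x\<in>conjugates (g \<alpha> \<beta>). f x) / real (card (conjugates (g \<alpha> \<beta>))) =
    (\<Sum>(a, b)\<in>conjugate_pairs \<alpha> \<beta>. f (g a b)) / real (card (conjugate_pairs \<alpha> \<beta>))"
proof -
  define S where "S = conjugate_pairs \<alpha> \<beta>"
  define g' where "g' p = g (fst p) (snd p)" for p
  define G where "G = Aut_over (\<rat> :: qbar set)"
  have S: "finite S"
    by (rule finite_subset[of _ "orbit \<rat> \<alpha> \<times> orbit \<rat> \<beta>"])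
      (auto simp: S_def conjugate_pairs_def orbit_def[symmetric] finite_orbit, auto simp: orbit_def)
  have "(\<alpha>, \<beta>) \<in> S"
    unfolding S_def conjugate_pairs_def by (rule image_eqI[OF _ Aut_over_id]) simp
  then have S': "S \<noteq> {}" by blast
  have image: "g' ` S = conjugates (g \<alpha> \<beta>)"
    unfolding S_def conjugate_pairs_def conjugates_eq_orbit orbit_def image_image g'_def
    by (rule image_cong) (simp_all add: g)
  define fib where "fib y = {p \<in> S. g' p = y}" for y
  have le: "card (fib y) \<le> card (fib (\<sigma> y))" if \<sigma>: "\<sigma> \<in> G" for \<sigma> y
  proof (rule card_inj_on_le)
    show "inj_on (map_prod \<sigma> \<sigma>) (fib y)"
      using \<sigma> by (intro inj_on_subset[OF prod.inj_map]) (auto simp: G_def Aut_over_iff bij_def)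
    show "map_prod \<sigma> \<sigma> ` fib y \<subseteq> fib (\<sigma> y)"
      using \<sigma> Aut_over_comp[of \<sigma> \<rat>]
      by (auto simp: fib_def S_def conjugate_pairs_def g'_def g G_def intro!: image_eqI[of _ _ "\<sigma> \<circ> _"])
    show "finite (fib (\<sigma> y))" using S by (simp add: fib_def)
  qed
  have "card (fib y) = card (fib (g \<alpha> \<beta>))" if y: "y \<in> g' ` S" for y
  proof -
    obtain \<sigma> where \<sigma>: "\<sigma> \<in> G" "y = \<sigma> (g \<alpha> \<beta>)"
      using y unfolding image conjugates_eq_orbit orbit_def G_def by blast
    have "inv_into UNIV \<sigma> y = g \<alpha> \<beta>"
      using \<sigma> by (simp add: G_def Aut_over_iff bij_is_inj)
    moreover have "inv_into UNIV \<sigma> \<in> G" using \<sigma>(1) Aut_over_inv by (simp add: G_def)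
    ultimately show ?thesis using le[OF \<sigma>(1), of "g \<alpha> \<beta>"] le[of "inv_into UNIV \<sigma>" y] \<sigma>(2)
      by simp
  qed
  then have "(\<Sum>x\<in>S. f (g' x)) / real (card S) = (\<Sum>y\<in>g' ` S. f y) / real (card (g' ` S))"
    unfolding fib_def by (intro average_image[OF S S'])
  also have "\<dots> = (\<Sum>y\<in>conjugates (g \<alpha> \<beta>). f y) / real (card (conjugates (g \<alpha> \<beta>)))"
    unfolding image ..
  finally show ?thesis
    by (simp add: S_def g'_def case_prod_unfold)
qed

lemma local_height_conjugate_pairs:
  assumes "\<And>\<sigma> a b. \<sigma> \<in> Aut_over \<rat> \<Longrightarrow> g (\<sigma> a) (\<sigma> b) = \<sigma> (g a b)"
  shows "local_height v (g \<alpha> \<beta>) =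
    (\<Sum>(a, b)\<in>conjugate_pairs \<alpha> \<beta>. ln (max 1 (place_ext v (g a b)))) / real (card (conjugate_pairs \<alpha> \<beta>))"
  unfolding local_height_def by (rule average_conjugate_pairs) (rule assms)

section \<open>Heights of products, powers and inverses\<close>

lemma Aut_over_hom: "\<sigma> \<in> Aut_over K \<Longrightarrow> is_ring_hom \<sigma>"
  by (simp add: Aut_over_iff)

lemma local_height_mult_le:
  assumes v: "v \<in> places_Q"
  shows "local_height v (\<alpha> * \<beta>) \<le> local_height v \<alpha> + local_height v \<beta>"
proof -
  note w = is_absolute_valueD[OF place_ext(1)[OF v]]
  have le: "ln (max 1 (place_ext v (a * b))) \<le> ln (max 1 (place_ext v a)) + ln (max 1 (place_ext v b))" for a b
  proof -
    have "max 1 (place_ext v (a * b)) \<le> max 1 (place_ext v a) * max 1 (place_ext v b)"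
      unfolding w(3) using w(1)[of a] w(1)[of b] mult_mono[of 1 "max 1 (place_ext v a)" 1 "max 1 (place_ext v b)"]
      by (intro max.boundedI mult_mono) auto
    then have "ln (max 1 (place_ext v (a * b))) \<le> ln (max 1 (place_ext v a) * max 1 (place_ext v b))"
      by (subst ln_le_cancel_iff) (auto intro!: mult_pos_pos)
    then show ?thesis by (auto simp: ln_mult max_def split: if_splits)
  qed
  let ?S = "conjugate_pairs \<alpha> \<beta>"
  have 1: "local_height v (\<alpha> * \<beta>) = (\<Sum>(a, b)\<in>?S. ln (max 1 (place_ext v (a * b)))) / real (card ?S)"
    by (rule local_height_conjugate_pairs) (simp add: is_ring_homD[OF Aut_over_hom])
  \<comment> \<open>The projections commute with automorphisms, so \<alpha> and \<beta> themselves
    are averaged over the same pairs as their product.\<close>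
  have 2: "local_height v \<alpha> = (\<Sum>(a, b)\<in>?S. ln (max 1 (place_ext v a))) / real (card ?S)"
    using local_height_conjugate_pairs[of "\<lambda>a b. a" v \<alpha> \<beta>] by simp
  have 3: "local_height v \<beta> = (\<Sum>(a, b)\<in>?S. ln (max 1 (place_ext v b))) / real (card ?S)"
    using local_height_conjugate_pairs[of "\<lambda>a b. b" v \<alpha> \<beta>] by simp
  show ?thesis
    unfolding 1 2 3 add_divide_distrib[symmetric] sum.distrib[symmetric]
    by (intro divide_right_mono sum_mono) (use le in auto)
qed

lemma weil_height_mult_le: "weil_height (\<alpha> * \<beta>) \<le> weil_height \<alpha> + weil_height \<beta>"
  unfolding weil_height_eq_infsum infsum_add[OF local_height_summable local_height_summable, symmetric]
  by (intro infsum_mono local_height_summable summable_on_add local_height_mult_le)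

lemma weil_height_power: "weil_height (\<alpha> ^ n) = real n * weil_height \<alpha>"
proof -
  have "local_height v (\<alpha> ^ n) = real n * local_height v \<alpha>" if v: "v \<in> places_Q" for v
  proof -
    note w = is_absolute_valueD[OF place_ext(1)[OF v]]
    have eq: "ln (max 1 (place_ext v (a ^ n))) = real n * ln (max 1 (place_ext v a))" for a
    proof -
      have "max 1 (place_ext v a ^ n) = max 1 (place_ext v a) ^ n"
        using w(1)[of a] by (cases "place_ext v a \<le> 1") (auto simp: max_def power_le_one one_le_power dest: antisym)
      then show ?thesis by (simp add: w(8) ln_realpow)
    qed
    \<comment> \<open>A power can have fewer conjugates than \<alpha>; diagonal pairs put both
      averages on one index set.\<close>
    let ?S = "conjugate_pairs \<alpha> \<alpha>"
    have 1: "local_height v (\<alpha> ^ n) = (\<Sum>(a, b)\<in>?S. ln (max 1 (place_ext v (a ^ n)))) / real (card ?S)"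
      using local_height_conjugate_pairs[of "\<lambda>a b. a ^ n" v \<alpha> \<alpha>]
      by (simp add: is_ring_homD[OF Aut_over_hom])
    have 2: "local_height v \<alpha> = (\<Sum>(a, b)\<in>?S. ln (max 1 (place_ext v a))) / real (card ?S)"
      using local_height_conjugate_pairs[of "\<lambda>a b. a" v \<alpha> \<alpha>] by simp
    show ?thesis unfolding 1 2 by (simp add: eq sum_distrib_left case_prod_unfold)
  qed
  then show ?thesis
    unfolding weil_height_eq_infsum infsum_cmult_right'[symmetric] by (intro infsum_cong)
qed

text \<open>For t > 0, ln max(1, t) = ln max(1, 1/t) + ln t. Over all conjugates the last terms add
  up to the logarithm of the absolute value of the norm \<open>q\<close>.\<close>

lemma local_height_inverse:
  assumes v: "v \<in> places_Q" and \<alpha>: "\<alpha> \<noteq> 0" and q: "of_rat q = \<Prod>(conjugates \<alpha>)"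
  shows "local_height v \<alpha> = local_height v (inverse \<alpha>) + 1 / real (card (conjugates \<alpha>)) * ln (v q)"
proof -
  note w = is_absolute_valueD[OF place_ext(1)[OF v]]
  let ?C = "conjugates \<alpha>"
  note nz = conjugates_nonzero[OF \<alpha>]
  have ci: "conjugates (inverse \<alpha>) = inverse ` ?C"
    unfolding conjugates_eq_orbit orbit_def image_image
    by (rule image_cong) (simp_all add: is_ring_hom_inverse[OF Aut_over_hom])
  have inj: "inj_on inverse ?C" by (auto intro: inj_onI)
  have eq: "ln (max 1 (place_ext v \<beta>)) = ln (max 1 (place_ext v (inverse \<beta>))) + ln (place_ext v \<beta>)"
    if "\<beta> \<in> ?C" for \<beta>
  proof -
    have pos: "place_ext v \<beta> > 0" using nz[OF that] w(1)[of \<beta>] w(2)[of \<beta>] by linarith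
    then show ?thesis
      by (cases "place_ext v \<beta> \<le> 1") (auto simp: w(9) max_def inverse_le_1_iff one_le_inverse_iff ln_inverse)
  qed
  have "v q = (\<Prod>\<beta>\<in>?C. place_ext v \<beta>)"
    using place_ext(2)[OF v, of q] by (simp add: q absolute_value_prod[OF place_ext(1)[OF v]])
  also have "ln \<dots> = (\<Sum>\<beta>\<in>?C. ln (place_ext v \<beta>))"
    by (rule ln_prod) (use nz w(1,2) in \<open>auto simp: less_le\<close>)
  finally have "ln (v q) = (\<Sum>\<beta>\<in>?C. ln (place_ext v \<beta>))" .
  moreover have "(\<Sum>\<beta>\<in>?C. ln (max 1 (place_ext v \<beta>))) =
      (\<Sum>\<beta>\<in>?C. ln (max 1 (place_ext v (inverse \<beta>)))) + (\<Sum>\<beta>\<in>?C. ln (place_ext v \<beta>))"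
    unfolding sum.distrib[symmetric] by (intro sum.cong refl eq)
  ultimately show ?thesis
    unfolding local_height_def ci card_image[OF inj] sum.reindex[OF inj]
    by (simp add: o_def add_divide_distrib)
qed

text \<open>The local error terms do not vanish one by one; their sum over all places does, by the
  product formula for the norm.\<close>

lemma weil_height_inverse:
  assumes \<alpha>: "\<alpha> \<noteq> 0"
  shows "weil_height (inverse \<alpha>) = weil_height \<alpha>"
proof -
  have "\<Prod>(conjugates \<alpha>) \<in> \<rat>"
    unfolding conjugates_eq_orbit by (rule prod_orbit_in_subfield) (simp_all add: is_subring_Rats)
  then obtain q where q: "\<Prod>(conjugates \<alpha>) = of_rat q" by (auto elim: Rats_cases)
  have "\<Prod>(conjugates \<alpha>) \<noteq> 0"
    using conjugates_nonzero[OF \<alpha>] by auto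
  then have "q \<noteq> 0" using q by auto
  note pf = product_formula_Q[OF this]
  let ?n = "real (card (conjugates \<alpha>))"
  have "weil_height \<alpha> = (\<Sum>\<^sub>\<infinity>v\<in>places_Q. local_height v (inverse \<alpha>) + 1 / ?n * ln (v q))"
    unfolding weil_height_eq_infsum by (intro infsum_cong local_height_inverse \<alpha> q[symmetric])
  also have "\<dots> = weil_height (inverse \<alpha>) + (\<Sum>\<^sub>\<infinity>v\<in>places_Q. 1 / ?n * ln (v q))"
    unfolding weil_height_eq_infsum
    by (intro infsum_add local_height_summable summable_on_cmult_right pf)
  also have "\<dots> = weil_height (inverse \<alpha>)" unfolding infsum_cmult_right' pf by simp
  finally show ?thesis ..
qed

lemma weil_height_one: "weil_height 1 = 0"
proof -
  have "weil_height (1 ^ 0) = real 0 * weil_height 1" by (rule weil_height_power)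
  then show ?thesis by simp
qed

lemma weil_height_root_of_unity: "n > 0 \<Longrightarrow> \<zeta> ^ n = 1 \<Longrightarrow> weil_height \<zeta> = 0"
  using weil_height_power[of \<zeta> n] weil_height_one by simp

lemma weil_height_prod_le: "weil_height (prod f I) \<le> (\<Sum>i\<in>I. weil_height (f i))"
proof (induction I rule: infinite_finite_induct)
  case (insert i I)
  then show ?case using weil_height_mult_le[of "f i" "prod f I"] by simp
qed (simp_all add: weil_height_one)

lemma weil_height_divide_commute: "\<alpha> \<noteq> 0 \<Longrightarrow> \<beta> \<noteq> 0 \<Longrightarrow> weil_height (\<alpha> / \<beta>) = weil_height (\<beta> / \<alpha>)"
  using weil_height_inverse[of "\<alpha> / \<beta>"] by simp

section \<open>Comparison of V and W\<close>

lemma Aut_over_div_closure: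
  assumes \<sigma>: "\<sigma> \<in> Aut_over K" and \<gamma>: "\<gamma> \<in> div_closure K"
  obtains n where "n > 0" "(\<sigma> \<gamma> / \<gamma>) ^ n = 1"
proof -
  have h: "is_ring_hom \<sigma>" "\<And>x. x \<in> K \<Longrightarrow> \<sigma> x = x" using \<sigma> by (auto simp: Aut_over_iff)
  obtain m :: int where m: "m \<noteq> 0" "\<gamma> powi m \<in> K" "\<gamma> \<noteq> 0" using \<gamma> by (auto simp: div_closure_def)
  define n where "n = nat \<bar>m\<bar>"
  have "\<sigma> (\<gamma> ^ n) = \<gamma> ^ n"
  proof (cases "m \<ge> 0")
    case True
    then show ?thesis using h(2)[OF m(2)] by (simp add: n_def power_int_def)
  next
    case False
    then have "\<gamma> powi m = inverse (\<gamma> ^ n)" by (simp add: n_def power_int_def power_inverse)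
    then show ?thesis using h(2)[OF m(2)] is_ring_hom_inverse[OF h(1), of "\<gamma> ^ n"] by simp
  qed
  then have "(\<sigma> \<gamma> / \<gamma>) ^ n = 1" using m(3) by (simp add: is_ring_homD[OF h(1)] power_divide)
  moreover have "n > 0" using m(1) by (simp add: n_def)
  ultimately show ?thesis using that by blast
qed

theorem theorem1p1:
  fixes K :: "qbar set" and \<alpha> :: qbar
  assumes "subfield K Qbar_ring" and "\<alpha> \<noteq> 0"
  shows "1 / 2 * W_height K \<alpha> \<le> V_height K \<alpha> \<and> V_height K \<alpha> \<le> W_height K \<alpha>"
proof
  note K = subfield_Qbar_ringD[OF assms(1)]
  have "1 \<in> div_closure K"
    using is_subringD(2)[OF K(1)] by (auto simp: div_closure_def intro: exI[of _ 1])
  then have ne: "div_closure K \<noteq> {}" by blast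
  have ne': "Aut_over K \<noteq> {}" using Aut_over_id by blast
  have bdd_below: "bdd_below ((\<lambda>\<gamma>. weil_height (\<alpha> / \<gamma>)) ` div_closure K)"
    by (rule bdd_belowI2[of _ 0]) (rule weil_height_nonneg)
  have le: "weil_height (\<sigma> \<alpha> / \<alpha>) \<le> 2 * weil_height (\<alpha> / \<gamma>)"
    if \<sigma>: "\<sigma> \<in> Aut_over K" and \<gamma>: "\<gamma> \<in> div_closure K" for \<sigma> \<gamma>
  proof -
    have h: "is_ring_hom \<sigma>" using \<sigma> by (rule Aut_over_hom)
    have "\<gamma> \<noteq> 0" using \<gamma> by (simp add: div_closure_def)
    then have nz: "\<sigma> \<gamma> \<noteq> 0" by (simp add: is_ring_hom_eq_0_iff[OF h])
    define \<beta> where "\<beta> = \<alpha> / \<gamma>"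
    have "\<beta> \<noteq> 0" using assms(2) \<open>\<gamma> \<noteq> 0\<close> by (simp add: \<beta>_def)
    obtain n where "n > 0" "(\<sigma> \<gamma> / \<gamma>) ^ n = 1" using Aut_over_div_closure[OF \<sigma> \<gamma>] .
    then have 0: "weil_height (\<sigma> \<gamma> / \<gamma>) = 0" by (rule weil_height_root_of_unity)
    have "\<sigma> \<alpha> / \<alpha> = (\<sigma> \<beta> * inverse \<beta>) * (\<sigma> \<gamma> / \<gamma>)"
      using assms(2) \<open>\<gamma> \<noteq> 0\<close> nz by (simp add: \<beta>_def is_ring_hom_divide[OF h] field_simps)
    then have "weil_height (\<sigma> \<alpha> / \<alpha>) \<le> weil_height (\<sigma> \<beta> * inverse \<beta>)"
      using weil_height_mult_le[of "\<sigma> \<beta> * inverse \<beta>" "\<sigma> \<gamma> / \<gamma>"] 0 by simp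
    also have "\<dots> \<le> weil_height (\<sigma> \<beta>) + weil_height (inverse \<beta>)" by (rule weil_height_mult_le)
    also have "\<dots> = 2 * weil_height \<beta>"
      using \<open>\<beta> \<noteq> 0\<close> by (simp add: weil_height_Aut_over[OF \<sigma>] weil_height_inverse)
    finally show ?thesis by (simp add: \<beta>_def)
  qed
  \<comment> \<open>The estimate \<open>le\<close> at \<gamma> = 1 bounds all the heights by twice
    the height of \<alpha>, so the real supremum is a genuine upper bound.\<close>
  have bdd_above: "bdd_above ((\<lambda>\<sigma>. weil_height (\<sigma> \<alpha> / \<alpha>)) ` Aut_over K)"
    by (rule bdd_aboveI2) (rule le[OF _ \<open>1 \<in> div_closure K\<close>])
  have "1 / 2 * W_height K \<alpha> \<le> weil_height (\<alpha> / \<gamma>)" if "\<gamma> \<in> div_closure K" for \<gamma>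
  proof -
    have "W_height K \<alpha> \<le> 2 * weil_height (\<alpha> / \<gamma>)"
      unfolding W_height_def using ne' le that by (intro cSUP_least)
    then show ?thesis by simp
  qed
  then show "1 / 2 * W_height K \<alpha> \<le> V_height K \<alpha>"
    unfolding V_height_def by (intro cINF_greatest ne)
  define C where "C = orbit K \<alpha>"
  define n where "n = card C"
  have C: "finite C" "\<alpha> \<in> C" by (simp_all add: C_def finite_orbit self_in_orbit)
  then have n: "n > 0" by (auto simp: n_def card_gt_0_iff)
  have nz: "\<beta> \<noteq> 0" if "\<beta> \<in> C" for \<beta>
    using that assms(2) by (auto simp: C_def orbit_def Aut_over_iff is_ring_hom_eq_0_iff)
  \<comment> \<open>A geometric mean of the conjugates: its n-th power is the norm, so it lies in
    \<open>div_closure K\<close>.\<close>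
  obtain \<gamma> where \<gamma>: "\<gamma> ^ n = \<Prod>C" using nth_root_exists[OF n] by blast
  have "\<gamma> ^ n \<noteq> 0" unfolding \<gamma> using nz C(1) by auto
  moreover have "\<gamma> ^ n \<in> K" unfolding \<gamma> C_def by (rule prod_orbit_in_subfield[OF K(1,2)])
  ultimately have "\<gamma> \<in> div_closure K"
    using n by (auto simp: div_closure_def intro!: exI[of _ "int n"])
  then have "V_height K \<alpha> \<le> weil_height (\<alpha> / \<gamma>)"
    unfolding V_height_def by (intro cINF_lower bdd_below)
  also have "\<dots> \<le> W_height K \<alpha>"
  proof -
    \<comment> \<open>Since n is the number of conjugates, \<open>\<alpha> ^ n\<close> is a product
      of copies of \<alpha> indexed by \<open>C\<close> and can be matched factor by factor with the
      norm.\<close>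
    have "real n * weil_height (\<alpha> / \<gamma>) = weil_height (\<Prod>\<beta>\<in>C. \<alpha> / \<beta>)"
      by (simp add: weil_height_power[symmetric] power_divide \<gamma> prod_dividef) (simp add: n_def)
    also have "\<dots> \<le> (\<Sum>\<beta>\<in>C. weil_height (\<alpha> / \<beta>))" by (rule weil_height_prod_le)
    also have "\<dots> \<le> (\<Sum>\<beta>\<in>C. W_height K \<alpha>)"
    proof (rule sum_mono)
      fix \<beta> assume \<beta>: "\<beta> \<in> C"
      then obtain \<sigma> where \<sigma>: "\<sigma> \<in> Aut_over K" "\<beta> = \<sigma> \<alpha>" by (auto simp: C_def orbit_def)
      have "weil_height (\<alpha> / \<beta>) = weil_height (\<sigma> \<alpha> / \<alpha>)"
        using weil_height_divide_commute[OF assms(2) nz[OF \<beta>]] \<sigma>(2) by simp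
      also have "\<dots> \<le> W_height K \<alpha>"
        unfolding W_height_def by (rule cSUP_upper[OF \<sigma>(1) bdd_above])
      finally show "weil_height (\<alpha> / \<beta>) \<le> W_height K \<alpha>" .
    qed
    finally show ?thesis using n by (simp add: n_def)
  qed
  finally show "V_height K \<alpha> \<le> W_height K \<alpha>" .
qed

end
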